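(* The proof system $CBV$ is complete in the sense of Cook: for every interpretation $I$ such that $\mathcal L$ is expressive relative to $I$, every program $(D\mid S)$ and all assertions $p,q$, if $I\models\{p\}S\{q\}$ then $\vdash_I\{p\}S\{q\}$.
   Context: Fix a first-order language $\mathcal L$; expressions are terms, Boolean expressions quantifier-free formulas, assertions formulas of $\mathcal L$; $free(p)$ is the set of free variables of $p$; $p[\bar x:=\bar t]$ is simultaneous substitution. Statements: $S ::= skip \mid \bar{x}:=\bar{t} \mid P(\bar{t}) \mid S;S \mid \mathbf{if}\ B\ \mathbf{then}\ S\ \mathbf{else}\ S\ \mathbf{fi} \mid \mathbf{while}\ B\ \mathbf{do}\ S\ \mathbf{od} \mid \mathbf{begin\ local}\ \bar{x}:=\bar{t};\ S\ \mathbf{end}$ (parallel assignment of expressions to a list of distinct variables; calls with actual parameters; blocks with initialized local variables). A declaration $P(\bar u)::S$ has distinct formal parameters $\bar u$ and body $S$; a program $(D\mid S)$ has a fixed set $D$ of declarations with exactly one for each procedure name occurring in it. $var(D\mid S)$ is the set of variables occurring in the program. $change$: $change(D\mid skip)=\emptyset$; $change(D\mid\bar x:=\bar t)=\{\bar x\}$; $change(D\mid P(\bar t))=change(D)\setminus\{\bar u\}$ if $P(\bar u)::S\in D$, $\emptyset$ otherwise; composition/conditional: union of components; while: that of the body; $change(D\mid\mathbf{begin\ local}\ \bar x:=\bar t;\ S\ \mathbf{end})=change(D\mid S)\setminus\{\bar x\}$; $change(P(\bar u)::S)=change(\emptyset\mid S)$; $change(D)=\bigcup_{d\in D}change(d)$.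 Semantics: for an interpretation $I$, states map variables to the domain; $\sigma(t)$, updates $\sigma[\bar x:=\bar d]$, $[\![p]\!]_I$ the states satisfying $p$. $\mathcal M_I[\![S]\!](\sigma)=\{\tau\}$ if $S$ started in $\sigma$ terminates in $\tau$, else $\emptyset$ (standard input/output semantics; blocks restore old values: $\mathcal M_I[\![\mathbf{begin\ local}\ \bar x:=\bar t;\ S\ \mathbf{end}]\!](\sigma)=\mathcal M_I[\![\bar x:=\bar t;\ S]\!](\sigma)[\bar x:=\sigma(\bar x)]$; a call $P(\bar t)$ with $P(\bar u)::S\in D$ has the meaning of $\mathbf{begin\ local}\ \bar u:=\bar t;\ S\ \mathbf{end}$, i.e. call-by-value by inlining with dynamic scope). $I\models\{p\}S\{q\}$ iff $\mathcal M_I[\![S]\!]([\![p]\!]_I)\subseteq[\![q]\!]_I$. $\mathcal L$ is expressive relative to $I$ if for every assertion $p$ and program $(D\mid S)$ the set $\mathcal M_I[\![S]\!]([\![p]\!]_I)$ equals $[\![\phi]\!]_I$ for some formula $\phi$ of $\mathcal L$. Proof system $CBV$: SKIP $\{p\}skip\{p\}$; PARALLEL ASSIGNMENT $\{p[\bar x:=\bar t]\}\bar x:=\bar t\{p\}$; COMPOSITION; CONDITIONAL (from $\{p\wedge B\}S_1\{q\}$, $\{p\wedge\neg B\}S_2\{q\}$); LOOP (from $\{p\wedge B\}S\{p\}$ infer $\{p\}\mathbf{while}\ B\ \mathbf{do}\ S\ \mathbf{od}\{p\wedge\neg B\}$); RECURSION: from $\Phi\vdash\{p\}S\{q\}$ and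 $\Phi\vdash\{p_i\}S_i\{q_i\}$, $i\in\{1,\dots,n\}$, infer $\{p\}S\{q\}$, where $D=\{P_i(\bar u_i)::S_i\mid i\le n\}$, $\Phi=\{\{p_i\}P_i(\bar u_i)\{q_i\}\mid i\le n\}$, $\{\bar u_i\}\cap free(q_i)=\emptyset$, and $\vdash$ denotes provability from $\Phi$ using the remaining axioms and rules; PROCEDURE CALL: from $\{p\}P(\bar u)\{q\}$ infer $\{p[\bar u:=\bar t]\}P(\bar t)\{q\}$ where $P(\bar u)::S\in D$ and $\{\bar u\}\cap free(q)=\emptyset$; BLOCK: from $\{p\}\bar x:=\bar t;S\{q\}$ infer $\{p\}\mathbf{begin\ local}\ \bar x:=\bar t;\ S\ \mathbf{end}\{q\}$ if $\{\bar x\}\cap free(q)=\emptyset$; SUBSTITUTION: from $\{p\}S\{q\}$ infer $\{p[\bar x:=\bar y]\}S\{q[\bar x:=\bar y]\}$ if $\{\bar x\}\cap var(D\mid S)=\emptyset$ and $\{\bar y\}\cap change(D\mid S)=\emptyset$; INVARIANCE: from $\{r\}S\{q\}$ infer $\{p\wedge r\}S\{p\wedge q\}$ if $free(p)\cap change(D\mid S)=\emptyset$; $\exists$-INTRODUCTION: from $\{p\}S\{q\}$ infer $\{\exists\bar x:p\}S\{q\}$ if $\{\bar x\}\cap(var(D\mid S)\cup free(q))=\emptyset$; CONSEQUENCE: from $p\to p_1$, $\{p_1\}S\{q_1\}$, $q_1\to q$ infer $\{p\}S\{q\}$. $\vdash_I\{p\}S\{q\}$ means derivability in $CBV$ with all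 assertions true in $I$ available as premises of CONSEQUENCE. *)

theory Defs
  imports Main
begin

text \<open>
  Equality is a logical symbol, and variables are named. A signature is a set of function symbols
  and a set of relation symbols, each paired with its arity; constants are function symbols of
  arity 0. The domain of an interpretation is the whole
  type \<^typ>\<open>'a\<close>.
\<close>

type_synonym var = nat

record ('f, 'r) lang =
  funs :: "('f \<times> nat) set"
  rels :: "('r \<times> nat) set"

record ('f, 'r, 'a) interp =
  fun_int :: "'f \<Rightarrow> 'a list \<Rightarrow> 'a"
  rel_int :: "'r \<Rightarrow> 'a list \<Rightarrow> bool"

type_synonym 'a state = "var \<Rightarrow> 'a"

datatype 'f tm = Var var | Fn 'f "'f tm list"

datatype ('f, 'r) fm =
    Eq "'f tm" "'f tm"
  | Rel 'r "'f tm list"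
  | Neg "('f, 'r) fm"
  | And "('f, 'r) fm" "('f, 'r) fm"
  | Ex var "('f, 'r) fm"

definition Imp :: "('f, 'r) fm \<Rightarrow> ('f, 'r) fm \<Rightarrow> ('f, 'r) fm" where
  "Imp p q = Neg (And p (Neg q))"

definition Exs :: "var list \<Rightarrow> ('f, 'r) fm \<Rightarrow> ('f, 'r) fm" where
  "Exs xs p = foldr Ex xs p"

fun tm_over :: "('f, 'r) lang \<Rightarrow> 'f tm \<Rightarrow> bool" where
  "tm_over L (Var x) \<longleftrightarrow> True"
| "tm_over L (Fn f ts) \<longleftrightarrow> (f, length ts) \<in> funs L \<and> (\<forall>t \<in> set ts. tm_over L t)"

primrec fm_over :: "('f, 'r) lang \<Rightarrow> ('f, 'r) fm \<Rightarrow> bool" where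
  "fm_over L (Eq s t) \<longleftrightarrow> tm_over L s \<and> tm_over L t"
| "fm_over L (Rel r ts) \<longleftrightarrow> (r, length ts) \<in> rels L \<and> (\<forall>t \<in> set ts. tm_over L t)"
| "fm_over L (Neg p) \<longleftrightarrow> fm_over L p"
| "fm_over L (And p q) \<longleftrightarrow> fm_over L p \<and> fm_over L q"
| "fm_over L (Ex x p) \<longleftrightarrow> fm_over L p"

primrec quantifier_free :: "('f, 'r) fm \<Rightarrow> bool" where
  "quantifier_free (Eq s t) \<longleftrightarrow> True"
| "quantifier_free (Rel r ts) \<longleftrightarrow> True"
| "quantifier_free (Neg p) \<longleftrightarrow> quantifier_free p"
| "quantifier_free (And p q) \<longleftrightarrow> quantifier_free p \<and> quantifier_free q"
| "quantifier_free (Ex x p) \<longleftrightarrow> False"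

primrec tm_vars :: "'f tm \<Rightarrow> var set" where
  "tm_vars (Var x) = {x}"
| "tm_vars (Fn f ts) = \<Union> (set (map tm_vars ts))"

primrec free :: "('f, 'r) fm \<Rightarrow> var set" where
  "free (Eq s t) = tm_vars s \<union> tm_vars t"
| "free (Rel r ts) = \<Union> (set (map tm_vars ts))"
| "free (Neg p) = free p"
| "free (And p q) = free p \<union> free q"
| "free (Ex x p) = free p - {x}"

primrec tm_val :: "('f, 'r, 'a) interp \<Rightarrow> 'a state \<Rightarrow> 'f tm \<Rightarrow> 'a" where
  "tm_val I \<sigma> (Var x) = \<sigma> x"
| "tm_val I \<sigma> (Fn f ts) = fun_int I f (map (tm_val I \<sigma>) ts)"

primrec sat :: "('f, 'r, 'a) interp \<Rightarrow> 'a state \<Rightarrow> ('f, 'r) fm \<Rightarrow> bool" where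
  "sat I \<sigma> (Eq s t) \<longleftrightarrow> tm_val I \<sigma> s = tm_val I \<sigma> t"
| "sat I \<sigma> (Rel r ts) \<longleftrightarrow> rel_int I r (map (tm_val I \<sigma>) ts)"
| "sat I \<sigma> (Neg p) \<longleftrightarrow> \<not> sat I \<sigma> p"
| "sat I \<sigma> (And p q) \<longleftrightarrow> sat I \<sigma> p \<and> sat I \<sigma> q"
| "sat I \<sigma> (Ex x p) \<longleftrightarrow> (\<exists>d. sat I (\<sigma>(x := d)) p)"

definition states :: "('f, 'r, 'a) interp \<Rightarrow> ('f, 'r) fm \<Rightarrow> 'a state set" where
  "states I p = {\<sigma>. sat I \<sigma> p}"

definition true_in :: "('f, 'r, 'a) interp \<Rightarrow> ('f, 'r) fm \<Rightarrow> bool" where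
  "true_in I p \<longleftrightarrow> (\<forall>\<sigma>. sat I \<sigma> p)"

text \<open>
  Simultaneous update; it serves both for states and (starting from \<^const>\<open>Var\<close>) for
  substitutions.
\<close>

definition upd :: "(var \<Rightarrow> 'b) \<Rightarrow> var list \<Rightarrow> 'b list \<Rightarrow> var \<Rightarrow> 'b" where
  "upd \<sigma> xs ds = (\<lambda>y. case map_of (zip xs ds) y of Some d \<Rightarrow> d | None \<Rightarrow> \<sigma> y)"

primrec tm_subst :: "(var \<Rightarrow> 'f tm) \<Rightarrow> 'f tm \<Rightarrow> 'f tm" where
  "tm_subst s (Var x) = s x"
| "tm_subst s (Fn f ts) = Fn f (map (tm_subst s) ts)"

text \<open>Capture-avoiding: a bound variable is renamed only if it would capture.\<close>

primrec fm_subst :: "(var \<Rightarrow> 'f tm) \<Rightarrow> ('f, 'r) fm \<Rightarrow> ('f, 'r) fm" where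
  "fm_subst s (Eq t u) = Eq (tm_subst s t) (tm_subst s u)"
| "fm_subst s (Rel r ts) = Rel r (map (tm_subst s) ts)"
| "fm_subst s (Neg p) = Neg (fm_subst s p)"
| "fm_subst s (And p q) = And (fm_subst s p) (fm_subst s q)"
| "fm_subst s (Ex x p) =
    (let V = (\<Union>y \<in> free p - {x}. tm_vars (s y));
         z = (if x \<in> V then LEAST z. z \<notin> V else x)
     in Ex z (fm_subst (s(x := Var z)) p))"

definition subst :: "('f, 'r) fm \<Rightarrow> var list \<Rightarrow> 'f tm list \<Rightarrow> ('f, 'r) fm" where
  "subst p xs ts = fm_subst (upd Var xs ts) p"

lemma finite_tm_vars: "finite (tm_vars t)"
  by (induction t) auto

lemma finite_free: "finite (free p)"
  by (induction p) (auto simp: finite_tm_vars)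

lemma tm_val_cong: "(\<And>x. x \<in> tm_vars t \<Longrightarrow> \<sigma> x = \<tau> x) \<Longrightarrow> tm_val I \<sigma> t = tm_val I \<tau> t"
proof (induction t)
  case (Fn f ts)
  have "map (tm_val I \<sigma>) ts = map (tm_val I \<tau>) ts"
    using Fn.prems by (intro map_cong refl Fn.IH) auto
  then show ?case by (simp only: tm_val.simps)
qed simp

lemma sat_cong: "(\<And>x. x \<in> free p \<Longrightarrow> \<sigma> x = \<tau> x) \<Longrightarrow> sat I \<sigma> p \<longleftrightarrow> sat I \<tau> p"
proof (induction p arbitrary: \<sigma> \<tau>)
  case (Eq s t)
  have "tm_val I \<sigma> s = tm_val I \<tau> s" "tm_val I \<sigma> t = tm_val I \<tau> t"
    by (rule tm_val_cong, rule Eq, simp)+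
  then show ?case by (simp only: sat.simps)
next
  case (Rel r ts)
  have "map (tm_val I \<sigma>) ts = map (tm_val I \<tau>) ts"
    by (intro map_cong refl tm_val_cong Rel) auto
  then show ?case by (simp only: sat.simps)
next
  case (Neg p)
  have "sat I \<sigma> p \<longleftrightarrow> sat I \<tau> p"
    by (rule Neg.IH) (rule Neg.prems, simp)
  then show ?case by (simp only: sat.simps)
next
  case (And p q)
  have "sat I \<sigma> p \<longleftrightarrow> sat I \<tau> p" "sat I \<sigma> q \<longleftrightarrow> sat I \<tau> q"
    by (rule And.IH, rule And.prems, simp)+
  then show ?case by (simp only: sat.simps)
next
  case (Ex x p)
  have "sat I (\<sigma>(x := d)) p \<longleftrightarrow> sat I (\<tau>(x := d)) p" for d
    by (rule Ex.IH) (use Ex.prems in auto)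
  then show ?case by (simp only: sat.simps)
qed

lemma tm_val_subst: "tm_val I \<sigma> (tm_subst s t) = tm_val I (\<lambda>x. tm_val I \<sigma> (s x)) t"
  by (induction t) (auto simp: comp_def intro!: arg_cong[where f = "fun_int I _"])

lemma sat_fm_subst: "sat I \<sigma> (fm_subst s p) \<longleftrightarrow> sat I (\<lambda>x. tm_val I \<sigma> (s x)) p"
proof (induction p arbitrary: \<sigma> s)
  case (Rel r ts)
  have "map (tm_val I \<sigma>) (map (tm_subst s) ts) = map (tm_val I (\<lambda>x. tm_val I \<sigma> (s x))) ts"
    by (simp add: tm_val_subst)
  then show ?case by (simp only: sat.simps fm_subst.simps)
next
  case (Ex x p)
  define V where "V = (\<Union>y \<in> free p - {x}. tm_vars (s y))"
  define z where "z = (if x \<in> V then LEAST z. z \<notin> V else x)"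
  have "finite V" unfolding V_def by (auto simp: finite_free finite_tm_vars)
  then have "\<exists>z. z \<notin> V" using ex_new_if_finite infinite_UNIV_nat by blast
  then have "(LEAST z. z \<notin> V) \<notin> V" by (rule LeastI_ex)
  then have z: "z \<notin> V" by (simp add: z_def)
  have "sat I (\<lambda>y. tm_val I (\<sigma>(z := d)) ((s(x := Var z)) y)) p
      \<longleftrightarrow> sat I ((\<lambda>y. tm_val I \<sigma> (s y))(x := d)) p" for d
    by (rule sat_cong) (use z in \<open>auto simp: V_def intro!: tm_val_cong\<close>)
  then have "sat I \<sigma> (Ex z (fm_subst (s(x := Var z)) p)) \<longleftrightarrow> sat I (\<lambda>x. tm_val I \<sigma> (s x)) (Ex x p)"
    by (simp only: sat.simps Ex.IH)
  moreover have "fm_subst s (Ex x p) = Ex z (fm_subst (s(x := Var z)) p)"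
    unfolding fm_subst.simps Let_def V_def z_def ..
  ultimately show ?case by (simp only:)
qed (auto simp: tm_val_subst)

type_synonym pname = nat

datatype ('f, 'r) stmt =
    Skip
  | Assign "var list" "'f tm list"
  | Call pname "'f tm list"
  | Seq "('f, 'r) stmt" "('f, 'r) stmt"
  | Cond "('f, 'r) fm" "('f, 'r) stmt" "('f, 'r) stmt"
  | While "('f, 'r) fm" "('f, 'r) stmt"
  | Block "var list" "'f tm list" "('f, 'r) stmt"

type_synonym ('f, 'r) decl = "pname \<times> var list \<times> ('f, 'r) stmt"

primrec called :: "('f, 'r) stmt \<Rightarrow> pname set" where
  "called Skip = {}"
| "called (Assign xs ts) = {}"
| "called (Call P ts) = {P}"
| "called (Seq S1 S2) = called S1 \<union> called S2"
| "called (Cond B S1 S2) = called S1 \<union> called S2"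
| "called (While B S) = called S"
| "called (Block xs ts S) = called S"

definition pnames :: "('f, 'r) decl set \<Rightarrow> ('f, 'r) stmt \<Rightarrow> pname set" where
  "pnames D S = called S \<union> (\<Union>(P, us, B) \<in> D. insert P (called B))"

primrec stmt_over :: "('f, 'r) lang \<Rightarrow> ('f, 'r) decl set \<Rightarrow> ('f, 'r) stmt \<Rightarrow> bool" where
  "stmt_over L D Skip \<longleftrightarrow> True"
| "stmt_over L D (Assign xs ts) \<longleftrightarrow>
    distinct xs \<and> length ts = length xs \<and> (\<forall>t \<in> set ts. tm_over L t)"
| "stmt_over L D (Call P ts) \<longleftrightarrow>
    (\<forall>us B. (P, us, B) \<in> D \<longrightarrow> length ts = length us) \<and> (\<forall>t \<in> set ts. tm_over L t)"
| "stmt_over L D (Seq S1 S2) \<longleftrightarrow> stmt_over L D S1 \<and> stmt_over L D S2"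
| "stmt_over L D (Cond B S1 S2) \<longleftrightarrow>
    fm_over L B \<and> quantifier_free B \<and> stmt_over L D S1 \<and> stmt_over L D S2"
| "stmt_over L D (While B S) \<longleftrightarrow> fm_over L B \<and> quantifier_free B \<and> stmt_over L D S"
| "stmt_over L D (Block xs ts S) \<longleftrightarrow>
    distinct xs \<and> length ts = length xs \<and> (\<forall>t \<in> set ts. tm_over L t) \<and> stmt_over L D S"

definition program :: "('f, 'r) lang \<Rightarrow> ('f, 'r) decl set \<Rightarrow> ('f, 'r) stmt \<Rightarrow> bool" where
  "program L D S \<longleftrightarrow>
    finite D \<and>
    (\<forall>P \<in> pnames D S. \<exists>!d. d \<in> D \<and> fst d = P) \<and>
    (\<forall>(P, us, B) \<in> D. distinct us \<and> stmt_over L D B) \<and>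
    stmt_over L D S"

primrec stmt_vars :: "('f, 'r) stmt \<Rightarrow> var set" where
  "stmt_vars Skip = {}"
| "stmt_vars (Assign xs ts) = set xs \<union> \<Union> (set (map tm_vars ts))"
| "stmt_vars (Call P ts) = \<Union> (set (map tm_vars ts))"
| "stmt_vars (Seq S1 S2) = stmt_vars S1 \<union> stmt_vars S2"
| "stmt_vars (Cond B S1 S2) = free B \<union> stmt_vars S1 \<union> stmt_vars S2"
| "stmt_vars (While B S) = free B \<union> stmt_vars S"
| "stmt_vars (Block xs ts S) = set xs \<union> \<Union> (set (map tm_vars ts)) \<union> stmt_vars S"

definition prog_vars :: "('f, 'r) decl set \<Rightarrow> ('f, 'r) stmt \<Rightarrow> var set" where
  "prog_vars D S = (\<Union>(P, us, B) \<in> D. set us \<union> stmt_vars B) \<union> stmt_vars S"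

text \<open>
  The parameter \<open>C\<close> gives the change set of a call. Bodies of declarations contribute with the
  empty set of declarations, i.e. with calls contributing nothing.
\<close>

primrec change_with :: "(pname \<Rightarrow> var set) \<Rightarrow> ('f, 'r) stmt \<Rightarrow> var set" where
  "change_with C Skip = {}"
| "change_with C (Assign xs ts) = set xs"
| "change_with C (Call P ts) = C P"
| "change_with C (Seq S1 S2) = change_with C S1 \<union> change_with C S2"
| "change_with C (Cond B S1 S2) = change_with C S1 \<union> change_with C S2"
| "change_with C (While B S) = change_with C S"
| "change_with C (Block xs ts S) = change_with C S - set xs"

definition decls_change :: "('f, 'r) decl set \<Rightarrow> var set" where
  "decls_change D = (\<Union>(P, us, B) \<in> D. change_with (\<lambda>_. {}) B)"

definition change :: "('f, 'r) decl set \<Rightarrow> ('f, 'r) stmt \<Rightarrow> var set" where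
  "change D S = change_with (\<lambda>P. \<Union>{decls_change D - set us | us B. (P, us, B) \<in> D}) S"

lemma change_empty: "change {} S = change_with (\<lambda>_. {}) S"
  by (simp add: change_def)

lemma decls_change_eq: "decls_change D = (\<Union>(P, us, B) \<in> D. change {} B)"
  by (simp add: decls_change_def change_empty)

lemma change_Call_declared:
  assumes "program L D S" "(P, us, B) \<in> D"
  shows "change D (Call P ts) = decls_change D - set us"
proof -
  have "P \<in> pnames D S" using assms(2) by (auto simp: pnames_def)
  then have ex1: "\<exists>!d. d \<in> D \<and> fst d = P" using assms(1) by (simp add: program_def)
  have eq: "us' = us" if "(P, us', B') \<in> D" for us' B'
    using ex1E[OF ex1] assms(2) that by (metis (no_types, lifting) fst_conv snd_conv)
  have "\<Union>{decls_change D - set us' | us' B'. (P, us', B') \<in> D} = decls_change D - set us"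
  proof (rule antisym)
    show "\<Union>{decls_change D - set us' | us' B'. (P, us', B') \<in> D} \<subseteq> decls_change D - set us"
      by (rule Union_least) (use eq in blast)
    show "decls_change D - set us \<subseteq> \<Union>{decls_change D - set us' | us' B'. (P, us', B') \<in> D}"
      by (rule Union_upper) (use assms(2) in blast)
  qed
  then show ?thesis by (simp add: change_def)
qed

inductive exec ::
  "('f, 'r, 'a) interp \<Rightarrow> ('f, 'r) decl set \<Rightarrow> ('f, 'r) stmt \<Rightarrow> 'a state \<Rightarrow> 'a state \<Rightarrow> bool"
  for I D
where
  exec_Skip: "exec I D Skip \<sigma> \<sigma>"
| exec_Assign: "exec I D (Assign xs ts) \<sigma> (upd \<sigma> xs (map (tm_val I \<sigma>) ts))"
| exec_Call: "(P, us, B) \<in> D \<Longrightarrow> exec I D (Block us ts B) \<sigma> \<tau> \<Longrightarrow> exec I D (Call P ts) \<sigma> \<tau>"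
| exec_Seq: "exec I D S1 \<sigma> \<rho> \<Longrightarrow> exec I D S2 \<rho> \<tau> \<Longrightarrow> exec I D (Seq S1 S2) \<sigma> \<tau>"
| exec_Cond_true: "sat I \<sigma> B \<Longrightarrow> exec I D S1 \<sigma> \<tau> \<Longrightarrow> exec I D (Cond B S1 S2) \<sigma> \<tau>"
| exec_Cond_false: "\<not> sat I \<sigma> B \<Longrightarrow> exec I D S2 \<sigma> \<tau> \<Longrightarrow> exec I D (Cond B S1 S2) \<sigma> \<tau>"
| exec_While_true:
    "sat I \<sigma> B \<Longrightarrow> exec I D S \<sigma> \<rho> \<Longrightarrow> exec I D (While B S) \<rho> \<tau> \<Longrightarrow> exec I D (While B S) \<sigma> \<tau>"
| exec_While_false: "\<not> sat I \<sigma> B \<Longrightarrow> exec I D (While B S) \<sigma> \<sigma>"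
| exec_Block:
    "exec I D (Seq (Assign xs ts) S) \<sigma> \<tau> \<Longrightarrow> exec I D (Block xs ts S) \<sigma> (upd \<tau> xs (map \<sigma> xs))"

definition meaning ::
  "('f, 'r, 'a) interp \<Rightarrow> ('f, 'r) decl set \<Rightarrow> ('f, 'r) stmt \<Rightarrow> 'a state \<Rightarrow> 'a state set"
where
  "meaning I D S \<sigma> = {\<tau>. exec I D S \<sigma> \<tau>}"

type_synonym ('f, 'r) triple = "('f, 'r) fm \<times> ('f, 'r) stmt \<times> ('f, 'r) fm"

fun valid :: "('f, 'r, 'a) interp \<Rightarrow> ('f, 'r) decl set \<Rightarrow> ('f, 'r) triple \<Rightarrow> bool" where
  "valid I D (p, S, q) \<longleftrightarrow> (\<Union>\<sigma> \<in> states I p. meaning I D S \<sigma>) \<subseteq> states I q"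

definition expressive :: "('f, 'r) lang \<Rightarrow> ('f, 'r, 'a) interp \<Rightarrow> bool" where
  "expressive L I \<longleftrightarrow>
    (\<forall>p D S. fm_over L p \<longrightarrow> program L D S \<longrightarrow>
      (\<exists>\<phi>. fm_over L \<phi> \<and> (\<Union>\<sigma> \<in> states I p. meaning I D S \<sigma>) = states I \<phi>))"

text \<open>All axioms and rules of CBV except RECURSION; the list holds the premises.\<close>

inductive basic_rule ::
  "('f, 'r, 'a) interp \<Rightarrow> ('f, 'r) decl set \<Rightarrow> ('f, 'r) triple list \<Rightarrow> ('f, 'r) triple \<Rightarrow> bool"
  for I D
where
  skip: "basic_rule I D [] (p, Skip, p)"
| parallel_assignment: "basic_rule I D [] (subst p xs ts, Assign xs ts, p)"
| composition: "basic_rule I D [(p, S1, r), (r, S2, q)] (p, Seq S1 S2, q)"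
| conditional: "basic_rule I D [(And p B, S1, q), (And p (Neg B), S2, q)] (p, Cond B S1 S2, q)"
| loop: "basic_rule I D [(And p B, S, p)] (p, While B S, And p (Neg B))"
| procedure_call:
    "(P, us, B) \<in> D \<Longrightarrow> set us \<inter> free q = {} \<Longrightarrow>
     basic_rule I D [(p, Call P (map Var us), q)] (subst p us ts, Call P ts, q)"
| block:
    "set xs \<inter> free q = {} \<Longrightarrow>
     basic_rule I D [(p, Seq (Assign xs ts) S, q)] (p, Block xs ts S, q)"
| substitution:
    "distinct xs \<Longrightarrow> length ys = length xs \<Longrightarrow>
     set xs \<inter> prog_vars D S = {} \<Longrightarrow> set ys \<inter> change D S = {} \<Longrightarrow>
     basic_rule I D [(p, S, q)] (subst p xs (map Var ys), S, subst q xs (map Var ys))"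
| invariance:
    "free p \<inter> change D S = {} \<Longrightarrow> basic_rule I D [(r, S, q)] (And p r, S, And p q)"
| exists_introduction:
    "set xs \<inter> (prog_vars D S \<union> free q) = {} \<Longrightarrow> basic_rule I D [(p, S, q)] (Exs xs p, S, q)"
| consequence:
    "true_in I (Imp p p1) \<Longrightarrow> true_in I (Imp q1 q) \<Longrightarrow> basic_rule I D [(p1, S, q1)] (p, S, q)"

fun triple_over :: "('f, 'r) lang \<Rightarrow> ('f, 'r) decl set \<Rightarrow> ('f, 'r) triple \<Rightarrow> bool" where
  "triple_over L D (p, S, q) \<longleftrightarrow> fm_over L p \<and> program L D S \<and> fm_over L q"

text \<open>
  Derivability from the hypotheses \<open>\<Phi>\<close> by the rules \<open>R\<close>; every line of a derivation must be a
  correctness formula of the language.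
\<close>

inductive derivable ::
  "('f, 'r) lang \<Rightarrow> ('f, 'r) decl set \<Rightarrow> (('f, 'r) triple list \<Rightarrow> ('f, 'r) triple \<Rightarrow> bool) \<Rightarrow>
   ('f, 'r) triple set \<Rightarrow> ('f, 'r) triple \<Rightarrow> bool"
  for L D R \<Phi>
where
  hyp: "c \<in> \<Phi> \<Longrightarrow> triple_over L D c \<Longrightarrow> derivable L D R \<Phi> c"
| step:
    "R cs c \<Longrightarrow> (\<And>c'. c' \<in> set cs \<Longrightarrow> derivable L D R \<Phi> c') \<Longrightarrow> triple_over L D c \<Longrightarrow>
     derivable L D R \<Phi> c"

text \<open>
  The premises of RECURSION are derivability statements, not correctness formulas, so it has an
  empty list of premises here. The functions \<open>pre\<close> and \<open>post\<close> choose one specification for each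
  declared procedure.
\<close>

inductive recursion_rule ::
  "('f, 'r) lang \<Rightarrow> ('f, 'r, 'a) interp \<Rightarrow> ('f, 'r) decl set \<Rightarrow>
   ('f, 'r) triple list \<Rightarrow> ('f, 'r) triple \<Rightarrow> bool"
  for L I D
where
  recursion:
    "\<Phi> = {(pre P, Call P (map Var us), post P) | P us B. (P, us, B) \<in> D} \<Longrightarrow>
     derivable L D (basic_rule I D) \<Phi> (p, S, q) \<Longrightarrow>
     (\<And>P us B. (P, us, B) \<in> D \<Longrightarrow> derivable L D (basic_rule I D) \<Phi> (pre P, B, post P)) \<Longrightarrow>
     (\<And>P us B. (P, us, B) \<in> D \<Longrightarrow> set us \<inter> free (post P) = {}) \<Longrightarrow>
     recursion_rule L I D [] (p, S, q)"

definition cbv_derivable ::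
  "('f, 'r) lang \<Rightarrow> ('f, 'r, 'a) interp \<Rightarrow> ('f, 'r) decl set \<Rightarrow> ('f, 'r) triple \<Rightarrow> bool"
where
  "cbv_derivable L I D c \<longleftrightarrow>
    derivable L D (\<lambda>cs c. basic_rule I D cs c \<or> recursion_rule L I D cs c) {} c"

end

theory Submission
  imports Defs
begin

text \<open>
  With fresh copies \<open>z\<close> of the variables \<open>x\<close> occurring in the declarations, each procedure
  \<open>P(u) :: B\<close> gets the specification \<open>{x = z} P(u) {\<exists>u. sp(x = z, B)}\<close>, whose postcondition
  describes the graph of the body \<open>B\<close> with the formal parameters hidden. Every valid correctness
  formula is derivable from these specifications, by induction on the statement; the bodies meet
  them by construction, so RECURSION discharges them.

  For a call \<open>{p} P(t) {q}\<close>, SUBSTITUTION makes the copies fresh for \<open>p\<close> and \<open>q\<close>, and PROCEDURE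
  CALL passes the actual parameters. Since a call leaves the formal parameters unchanged, INVARIANCE
  may carry along \<open>p \<and> z\<^sub>u = t\<close> with only the other variables replaced by their copies. This
  determines the state before the call completely, so \<open>q\<close> follows from validity, and
  \<open>\<exists>\<close>-INTRODUCTION removes the copies.
\<close>

section \<open>Simultaneous updates and substitution\<close>

lemma upd_map: "upd \<sigma> xs (map h xs) y = (if y \<in> set xs then h y else \<sigma> y)"
  by (simp add: upd_def map_of_zip_map)

text \<open>The shift is injective, so \<open>y - N\<close> recovers the variable whose copy is
  \<open>y\<close>. Fresh copies are always taken by such a shift.\<close>

lemma upd_shift:
  "upd \<sigma> (map (\<lambda>x. x + N) xs) (map h xs) y =
    (if y \<in> (\<lambda>x. x + N) ` set xs then h (y - N) else \<sigma> y)"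
  using upd_map[of \<sigma> "map (\<lambda>x. x + N) xs" "\<lambda>z. h (z - N)" y] by (simp add: comp_def)

lemma upd_notin: "y \<notin> set xs \<Longrightarrow> upd \<sigma> xs ds y = \<sigma> y"
  by (auto simp: upd_def split: option.split dest: map_of_SomeD set_zip_leftD)

lemma upd_cong: "y \<in> A \<Longrightarrow> (\<And>y. y \<in> A \<Longrightarrow> \<sigma> y = \<tau> y) \<Longrightarrow> upd \<sigma> xs ds y = upd \<tau> xs ds y"
  by (auto simp: upd_def split: option.split)

lemma map_upd: "distinct xs \<Longrightarrow> length ds = length xs \<Longrightarrow> map (upd \<sigma> xs ds) xs = ds"
  by (rule nth_equalityI) (auto simp: upd_def map_of_zip_nth)

lemma tm_val_upd_Var: "tm_val I \<sigma> (upd Var xs ts x) = upd \<sigma> xs (map (tm_val I \<sigma>) ts) x"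
  by (auto simp: upd_def zip_map2 map_of_map split: option.split)

lemma sat_subst: "sat I \<sigma> (subst p xs ts) \<longleftrightarrow> sat I (upd \<sigma> xs (map (tm_val I \<sigma>) ts)) p"
  by (simp add: subst_def sat_fm_subst tm_val_upd_Var)

lemma tm_vars_tm_subst: "tm_vars (tm_subst s t) = (\<Union>y \<in> tm_vars t. tm_vars (s y))"
  by (induction t) auto

text \<open>In the quantifier case the bound variable is sent to \<open>Var z\<close>, and the new
  quantifier removes exactly \<open>z\<close>; all remaining variables come from terms substituted
  for free variables of the quantified formula.\<close>

lemma free_fm_subst: "free (fm_subst s p) \<subseteq> (\<Union>y \<in> free p. tm_vars (s y))"
proof (induction p arbitrary: s)
  case (Ex x p)
  define V where "V = (\<Union>y \<in> free p - {x}. tm_vars (s y))"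
  define z where "z = (if x \<in> V then LEAST z. z \<notin> V else x)"
  have eq: "fm_subst s (Ex x p) = Ex z (fm_subst (s(x := Var z)) p)"
    unfolding fm_subst.simps Let_def V_def z_def ..
  have "free (fm_subst s (Ex x p)) \<subseteq> (\<Union>y \<in> free p. tm_vars ((s(x := Var z)) y)) - {z}"
    unfolding eq free.simps by (intro Diff_mono Ex.IH subset_refl)
  also have "\<dots> \<subseteq> (\<Union>y \<in> free (Ex x p). tm_vars (s y))" by (auto split: if_splits)
  finally show ?case .
next
  case (And p q)
  show ?case using And.IH[of s] by auto
qed (auto simp: tm_vars_tm_subst)

lemma free_subst_Var:
  "free (subst p xs (map (\<lambda>x. Var (h x)) xs)) \<subseteq> (free p - set xs) \<union> h ` set xs"
  using free_fm_subst[of "upd Var xs (map (\<lambda>x. Var (h x)) xs)" p]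
  by (fastforce simp: subst_def upd_map split: if_splits)

text \<open>Here the copies are the variables being replaced. The bound does not subtract them,
  since it only serves to show that variables absent from \<open>p\<close> stay absent.\<close>

lemma free_subst_shift:
  "free (subst p (map (\<lambda>x. x + N) xs) (map (\<lambda>x. Var (h x)) xs)) \<subseteq> free p \<union> h ` set xs"
  using free_fm_subst[of "upd Var (map (\<lambda>x. x + N) xs) (map (\<lambda>x. Var (h x)) xs)" p]
  by (fastforce simp: subst_def upd_shift split: if_splits)

lemma tm_over_tm_subst: "tm_over L t \<Longrightarrow> (\<And>x. tm_over L (s x)) \<Longrightarrow> tm_over L (tm_subst s t)"
  by (induction t) auto

lemma fm_over_fm_subst: "fm_over L p \<Longrightarrow> (\<And>x. tm_over L (s x)) \<Longrightarrow> fm_over L (fm_subst s p)"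
proof (induction p arbitrary: s)
  case (Ex x p)
  then show ?case by (simp add: Let_def)
qed (auto simp: tm_over_tm_subst)

lemma fm_over_subst: "fm_over L p \<Longrightarrow> (\<And>t. t \<in> set ts \<Longrightarrow> tm_over L t) \<Longrightarrow> fm_over L (subst p xs ts)"
  unfolding subst_def
  by (rule fm_over_fm_subst)
    (auto simp: upd_def split: option.split dest!: map_of_SomeD dest: set_zip_rightD)

section \<open>Derived formulas\<close>

lemma sat_Imp [simp]: "sat I \<sigma> (Imp p q) \<longleftrightarrow> (sat I \<sigma> p \<longrightarrow> sat I \<sigma> q)"
  by (simp add: Imp_def)

lemma sat_Exs: "sat I \<sigma> (Exs xs p) \<longleftrightarrow> (\<exists>\<tau>. (\<forall>x. x \<notin> set xs \<longrightarrow> \<tau> x = \<sigma> x) \<and> sat I \<tau> p)"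
proof (induction xs arbitrary: \<sigma>)
  case Nil
  have "\<tau> = \<sigma>" if "\<forall>x. \<tau> x = \<sigma> x" for \<tau> using that by auto
  then show ?case by (auto simp: Exs_def)
next
  case (Cons y xs)
  have "sat I \<sigma> (Exs (y # xs) p) \<longleftrightarrow> (\<exists>d. sat I (\<sigma>(y := d)) (Exs xs p))"
    by (simp add: Exs_def)
  also have "\<dots> \<longleftrightarrow> (\<exists>d \<tau>. (\<forall>x. x \<notin> set xs \<longrightarrow> \<tau> x = (\<sigma>(y := d)) x) \<and> sat I \<tau> p)"
    by (simp only: Cons.IH)
  also have "\<dots> \<longleftrightarrow> (\<exists>\<tau>. (\<forall>x. x \<notin> set (y # xs) \<longrightarrow> \<tau> x = \<sigma> x) \<and> sat I \<tau> p)"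
    (is "?l \<longleftrightarrow> ?r")
  proof
    assume ?r
    then obtain \<tau> where "\<forall>x. x \<notin> set (y # xs) \<longrightarrow> \<tau> x = \<sigma> x" "sat I \<tau> p" by blast
    then show ?l by (intro exI[of _ "\<tau> y"] exI[of _ \<tau>]) auto
  next
    assume ?l
    then obtain d \<tau> where "\<forall>x. x \<notin> set xs \<longrightarrow> \<tau> x = (\<sigma>(y := d)) x" "sat I \<tau> p" by blast
    then show ?r by (intro exI[of _ \<tau>]) auto
  qed
  finally show ?case .
qed

lemma free_Exs: "free (Exs xs p) = free p - set xs"
  by (induction xs) (auto simp: Exs_def)

lemma fm_over_Exs [simp]: "fm_over L (Exs xs p) \<longleftrightarrow> fm_over L p"
  by (induction xs) (auto simp: Exs_def)

text \<open>The last conjunct is a closed formula true in every interpretation; it stands for the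
  empty conjunction, as the syntax has no truth constant.\<close>

definition Eqs :: "'f tm list \<Rightarrow> 'f tm list \<Rightarrow> ('f, 'r) fm" where
  "Eqs ss ts = foldr (\<lambda>(s, t). And (Eq s t)) (zip ss ts) (Ex 0 (Eq (Var 0) (Var 0)))"

lemma sat_Eqs:
  "length ss = length ts \<Longrightarrow>
   sat I \<sigma> (Eqs ss ts) \<longleftrightarrow> map (tm_val I \<sigma>) ss = map (tm_val I \<sigma>) ts"
  by (induction ss ts rule: list_induct2) (auto simp: Eqs_def)

lemma fm_over_Eqs:
  "(\<And>t. t \<in> set ss \<Longrightarrow> tm_over L t) \<Longrightarrow> (\<And>t. t \<in> set ts \<Longrightarrow> tm_over L t) \<Longrightarrow> fm_over L (Eqs ss ts)"
proof (induction ss arbitrary: ts)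
  case (Cons s ss)
  then show ?case by (cases ts) (auto simp: Eqs_def)
qed (auto simp: Eqs_def)

section \<open>Programs, their variables and their change sets\<close>

text \<open>Separates the demands on the declarations from those on the statement, so that
  components inherit them. Mere existence of declarations suffices on the right, because
  \<open>program L D Skip\<close> already makes every declared name unique.\<close>

lemma program_iff:
  "program L D S \<longleftrightarrow> program L D Skip \<and> stmt_over L D S \<and> called S \<subseteq> fst ` D"
proof
  assume S: "program L D S"
  have "P \<in> fst ` D" if "P \<in> called S" for P
  proof -
    have "P \<in> pnames D S" using that by (simp add: pnames_def)
    then have "\<exists>!d. d \<in> D \<and> fst d = P" using S by (simp add: program_def)
    then show ?thesis by blast
  qed
  then show "program L D Skip \<and> stmt_over L D S \<and> called S \<subseteq> fst ` D"
    using S by (auto simp: program_def pnames_def)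
next
  assume *: "program L D Skip \<and> stmt_over L D S \<and> called S \<subseteq> fst ` D"
  then have "pnames D S = pnames D Skip" by (fastforce simp: pnames_def)
  with * show "program L D S" unfolding program_def by auto
qed

lemma finite_stmt_vars: "finite (stmt_vars S)"
  by (induction S) (auto simp: finite_tm_vars finite_free)

lemma prog_vars_eq: "prog_vars D S = prog_vars D Skip \<union> stmt_vars S"
  by (auto simp: prog_vars_def)

lemma prog_vars_declared:
  "(P, us, B) \<in> D \<Longrightarrow> set us \<subseteq> prog_vars D Skip \<and> stmt_vars B \<subseteq> prog_vars D Skip"
  by (fastforce simp: prog_vars_def)

lemma finite_prog_vars: "finite D \<Longrightarrow> finite (prog_vars D S)"
  by (auto simp: prog_vars_def finite_stmt_vars)

lemma change_with_subset: "change_with C S \<subseteq> change_with (\<lambda>_. {}) S \<union> \<Union> (range C)"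
  by (induction S) auto

lemma change_with_stmt_vars: "change_with C S \<subseteq> stmt_vars S \<union> \<Union> (range C)"
  by (induction S) auto

text \<open>\<open>decls_change\<close> lets calls inside bodies contribute nothing. Counting them
  under \<open>D\<close> adds only sets of the form \<open>decls_change D - set us\<close>, so
  nothing outside \<open>decls_change D\<close> appears.\<close>

lemma change_declared:
  assumes "(P, us, B) \<in> D"
  shows "change D B \<subseteq> decls_change D"
proof -
  let ?C = "\<lambda>P. \<Union>{decls_change D - set us | us B. (P, us, B) \<in> D}"
  have "change_with (\<lambda>_. {}) B \<subseteq> decls_change D" using assms by (fastforce simp: decls_change_def)
  moreover have "\<Union> (range ?C) \<subseteq> decls_change D" by auto
  ultimately show ?thesis using change_with_subset[of ?C B] unfolding change_def by blast
qed

lemma decls_change_prog_vars: "decls_change D \<subseteq> prog_vars D S"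
proof -
  have "change_with (\<lambda>_. {}) B \<subseteq> stmt_vars B" for B :: "('a, 'b) stmt"
    using change_with_stmt_vars[of "\<lambda>_. {}" B] by auto
  then show ?thesis by (fastforce simp: decls_change_def prog_vars_def)
qed

lemma change_prog_vars: "change D S \<subseteq> prog_vars D S"
proof -
  let ?C = "\<lambda>P. \<Union>{decls_change D - set us | us B. (P, us, B) \<in> D}"
  have "\<Union> (range ?C) \<subseteq> decls_change D" by auto
  then show ?thesis
    using change_with_stmt_vars[of ?C S] decls_change_prog_vars[of D S] prog_vars_eq[of D S]
    unfolding change_def by blast
qed

section \<open>Dependence of executions on variables\<close>

text \<open>Induction on the execution. For a call, the inlined block changes at most what its body
  changes, minus the formal parameters, and this lies in the change set of the call.\<close>

lemma exec_change: "exec I D S \<sigma> \<tau> \<Longrightarrow> x \<notin> change D S \<Longrightarrow> \<tau> x = \<sigma> x"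
proof (induction rule: exec.induct)
  case (exec_Call P us B ts \<sigma> \<tau>)
  have "change D (Block us ts B) \<subseteq> decls_change D - set us"
    using change_declared[OF exec_Call.hyps(1)] by (auto simp: change_def)
  also have "\<dots> \<subseteq> change D (Call P ts)"
    unfolding change_def change_with.simps
    by (rule Union_upper) (use exec_Call.hyps(1) in blast)
  finally show ?case using exec_Call by auto
next
  case (exec_Block xs ts S \<sigma> \<tau>)
  then show ?case by (auto simp: change_def upd_map)
qed (auto simp: change_def upd_notin)

lemma exec_frame: "exec I D S \<sigma> \<tau> \<Longrightarrow> prog_vars D S \<subseteq> V \<Longrightarrow> x \<notin> V \<Longrightarrow> \<tau> x = \<sigma> x"
  using exec_change change_prog_vars by (metis subsetD)

text \<open>The intermediate states of the new run are merged in the same way as the final one: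
  values on \<open>V\<close> from the old run, all others from \<open>\<sigma>'\<close>. The set
  \<open>V\<close> contains the variables of all declarations, so it also covers the bodies entered
  by calls.\<close>

lemma exec_coincidence_merge:
  assumes "exec I D S \<sigma> \<tau>" "prog_vars D S \<subseteq> V" "\<And>x. x \<in> V \<Longrightarrow> \<sigma>' x = \<sigma> x"
  shows "exec I D S \<sigma>' (\<lambda>x. if x \<in> V then \<tau> x else \<sigma>' x)"
  using assms
proof (induction arbitrary: \<sigma>' rule: exec.induct)
  case (exec_Skip \<sigma>)
  then have "(\<lambda>x. if x \<in> V then \<sigma> x else \<sigma>' x) = \<sigma>'" by auto
  then show ?case by (simp add: exec.exec_Skip)
next
  case (exec_Assign xs ts \<sigma>)
  have V: "set xs \<subseteq> V" "\<And>t. t \<in> set ts \<Longrightarrow> tm_vars t \<subseteq> V"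
    using exec_Assign.prems(1) by (auto simp: prog_vars_def)
  have ts: "map (tm_val I \<sigma>') ts = map (tm_val I \<sigma>) ts"
    by (intro map_cong refl tm_val_cong) (use exec_Assign.prems(2) V in auto)
  have "(\<lambda>x. if x \<in> V then upd \<sigma> xs (map (tm_val I \<sigma>) ts) x else \<sigma>' x)
      = upd \<sigma>' xs (map (tm_val I \<sigma>') ts)"
    unfolding ts
    using V exec_Assign.prems(2)
    by (auto simp: fun_eq_iff upd_notin subset_iff upd_def split: option.split)
      (metis map_of_SomeD set_zip_leftD)+
  then show ?case by (simp add: exec.exec_Assign)
next
  case (exec_Call P us B ts \<sigma> \<tau>)
  have "prog_vars D (Block us ts B) \<subseteq> V"
    using exec_Call.prems(1) prog_vars_declared[OF exec_Call.hyps(1)]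
      prog_vars_eq[of D "Block us ts B"] prog_vars_eq[of D "Call P ts"] by auto
  then show ?case using exec_Call by (intro exec.exec_Call[OF exec_Call.hyps(1)]) auto
next
  case (exec_Seq S1 \<sigma> \<rho> S2 \<tau>)
  let ?\<rho> = "\<lambda>x. if x \<in> V then \<rho> x else \<sigma>' x"
  have V: "prog_vars D S1 \<subseteq> V" "prog_vars D S2 \<subseteq> V"
    using exec_Seq.prems(1) by (auto simp: prog_vars_def)
  have "exec I D S1 \<sigma>' ?\<rho>" using exec_Seq V by blast
  moreover have "exec I D S2 ?\<rho> (\<lambda>x. if x \<in> V then \<tau> x else ?\<rho> x)"
    by (rule exec_Seq.IH(2)[OF V(2)]) simp
  moreover have "(\<lambda>x. if x \<in> V then \<tau> x else ?\<rho> x) = (\<lambda>x. if x \<in> V then \<tau> x else \<sigma>' x)"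
    by auto
  ultimately show ?case by (auto intro: exec.exec_Seq)
next
  case (exec_Cond_true \<sigma> B S1 \<tau> S2)
  have V: "prog_vars D S1 \<subseteq> V" "free B \<subseteq> V"
    using exec_Cond_true.prems(1) by (auto simp: prog_vars_def)
  have "sat I \<sigma>' B \<longleftrightarrow> sat I \<sigma> B" by (rule sat_cong) (use exec_Cond_true.prems V in auto)
  then show ?case using exec_Cond_true V by (intro exec.exec_Cond_true) auto
next
  case (exec_Cond_false \<sigma> B S2 \<tau> S1)
  have V: "prog_vars D S2 \<subseteq> V" "free B \<subseteq> V"
    using exec_Cond_false.prems(1) by (auto simp: prog_vars_def)
  have "sat I \<sigma>' B \<longleftrightarrow> sat I \<sigma> B" by (rule sat_cong) (use exec_Cond_false.prems V in auto)
  then show ?case using exec_Cond_false V by (intro exec.exec_Cond_false) auto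
next
  case (exec_While_true \<sigma> B S \<rho> \<tau>)
  let ?\<rho> = "\<lambda>x. if x \<in> V then \<rho> x else \<sigma>' x"
  have V: "prog_vars D S \<subseteq> V" "free B \<subseteq> V"
    using exec_While_true.prems(1) by (auto simp: prog_vars_def)
  have "sat I \<sigma>' B \<longleftrightarrow> sat I \<sigma> B" by (rule sat_cong) (use exec_While_true.prems V in auto)
  moreover have "exec I D S \<sigma>' ?\<rho>" using exec_While_true V by blast
  moreover have "exec I D (While B S) ?\<rho> (\<lambda>x. if x \<in> V then \<tau> x else ?\<rho> x)"
    by (rule exec_While_true.IH(2)[OF exec_While_true.prems(1)]) simp
  moreover have "(\<lambda>x. if x \<in> V then \<tau> x else ?\<rho> x) = (\<lambda>x. if x \<in> V then \<tau> x else \<sigma>' x)"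
    by auto
  ultimately show ?case using exec_While_true.hyps(1) by (auto intro: exec.exec_While_true)
next
  case (exec_While_false \<sigma> B S)
  have V: "free B \<subseteq> V" using exec_While_false.prems(1) by (auto simp: prog_vars_def)
  have "sat I \<sigma>' B \<longleftrightarrow> sat I \<sigma> B" by (rule sat_cong) (use exec_While_false.prems V in auto)
  moreover have "(\<lambda>x. if x \<in> V then \<sigma> x else \<sigma>' x) = \<sigma>'" using exec_While_false.prems by auto
  ultimately show ?case using exec_While_false.hyps by (auto intro: exec.exec_While_false)
next
  case (exec_Block xs ts S \<sigma> \<tau>)
  have V: "prog_vars D (Seq (Assign xs ts) S) \<subseteq> V" "set xs \<subseteq> V"
    using exec_Block.prems(1) by (auto simp: prog_vars_def)
  have "(\<lambda>x. if x \<in> V then upd \<tau> xs (map \<sigma> xs) x else \<sigma>' x)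
      = upd (\<lambda>x. if x \<in> V then \<tau> x else \<sigma>' x) xs (map \<sigma>' xs)"
    using V(2) exec_Block.prems(2) by (auto simp: upd_map fun_eq_iff)
  then show ?case using exec_Block V by (auto intro!: exec.exec_Block)
qed

lemma exec_coincidence:
  assumes "exec I D S \<sigma> \<tau>" "prog_vars D S \<subseteq> V"
    and "\<And>x. x \<in> V \<Longrightarrow> \<sigma>' x = \<sigma> x" "\<And>x. x \<in> V \<Longrightarrow> \<tau>' x = \<tau> x" "\<And>x. x \<notin> V \<Longrightarrow> \<tau>' x = \<sigma>' x"
  shows "exec I D S \<sigma>' \<tau>'"
proof -
  have "(\<lambda>x. if x \<in> V then \<tau> x else \<sigma>' x) = \<tau>'" using assms(4,5) by auto
  then show ?thesis using exec_coincidence_merge[OF assms(1-3)] by simp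
qed

section \<open>Derivability and strongest postconditions\<close>

lemma derivable_over: "derivable L D R \<Phi> c \<Longrightarrow> triple_over L D c"
  by (erule derivable.cases) auto

lemma finite_bound:
  assumes "finite (A :: nat set)"
  obtains N where "\<And>x. x \<in> A \<Longrightarrow> x < N"
  using assms unfolding finite_nat_set_iff_bounded by blast

lemma valid_iff: "valid I D (p, S, q) \<longleftrightarrow> (\<forall>\<sigma> \<tau>. sat I \<sigma> p \<longrightarrow> exec I D S \<sigma> \<tau> \<longrightarrow> sat I \<tau> q)"
  by (auto simp: states_def meaning_def)

declare valid.simps [simp del]

text \<open>With \<open>Skip\<close> as the statement, \<open>program\<close> expresses that the
  declarations are well formed by themselves; the statement may then vary in inductions.\<close>

locale cook_setting =
  fixes L :: "('f, 'r) lang" and I :: "('f, 'r, 'a) interp" and D :: "('f, 'r) decl set"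
  assumes expr: "expressive L I" and decls: "program L D Skip"
begin

abbreviation derives :: "('f, 'r) triple set \<Rightarrow> ('f, 'r) triple \<Rightarrow> bool" where
  "derives \<Phi> c \<equiv> derivable L D (basic_rule I D) \<Phi> c"

definition complete :: "('f, 'r) triple set \<Rightarrow> ('f, 'r) stmt \<Rightarrow> bool" where
  "complete \<Phi> S \<longleftrightarrow>
    (\<forall>p q. fm_over L p \<longrightarrow> fm_over L q \<longrightarrow> valid I D (p, S, q) \<longrightarrow> derives \<Phi> (p, S, q))"

text \<open>The strongest postcondition as a formula. The choice is meaningful for an assertion over
  \<open>L\<close> and a program, where expressiveness supplies a candidate.\<close>

definition sp :: "('f, 'r) fm \<Rightarrow> ('f, 'r) stmt \<Rightarrow> ('f, 'r) fm" where
  "sp p S = (SOME \<phi>. fm_over L \<phi> \<and> (\<Union>\<sigma> \<in> states I p. meaning I D S \<sigma>) = states I \<phi>)"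

lemma sp:
  assumes "fm_over L p" "program L D S"
  shows fm_over_sp: "fm_over L (sp p S)"
    and sat_sp: "sat I \<tau> (sp p S) \<longleftrightarrow> (\<exists>\<sigma>. sat I \<sigma> p \<and> exec I D S \<sigma> \<tau>)"
proof -
  have "\<exists>\<phi>. fm_over L \<phi> \<and> (\<Union>\<sigma> \<in> states I p. meaning I D S \<sigma>) = states I \<phi>"
    using expr assms by (auto simp: expressive_def)
  from someI_ex[OF this]
  have *: "fm_over L (sp p S)" "(\<Union>\<sigma> \<in> states I p. meaning I D S \<sigma>) = states I (sp p S)"
    unfolding sp_def by auto
  show "fm_over L (sp p S)" by (rule *)
  have "\<tau> \<in> (\<Union>\<sigma> \<in> states I p. meaning I D S \<sigma>) \<longleftrightarrow> \<tau> \<in> states I (sp p S)"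
    by (simp only: *(2))
  then show "sat I \<tau> (sp p S) \<longleftrightarrow> (\<exists>\<sigma>. sat I \<sigma> p \<and> exec I D S \<sigma> \<tau>)"
    by (auto simp: states_def meaning_def)
qed

lemma finite_vars: "finite (prog_vars D S)"
  using decls by (intro finite_prog_vars) (simp add: program_def)

lemma declared_unique:
  assumes "(P, us, B) \<in> D" "(P, us', B') \<in> D"
  shows "us' = us \<and> B' = B"
proof -
  have "P \<in> pnames D Skip" using assms(1) by (auto simp: pnames_def)
  then have "\<exists>!d. d \<in> D \<and> fst d = P" using decls by (simp add: program_def)
  with assms show ?thesis by (metis fst_conv snd_conv)
qed

lemma declared_wf:
  assumes "(P, us, B) \<in> D"
  shows "distinct us" "program L D B" "program L D (Call P (map Var us))"
proof -
  have B: "distinct us \<and> stmt_over L D B" using decls assms by (auto simp: program_def)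
  then show "distinct us" by simp
  have "called B \<subseteq> fst ` D"
  proof
    fix Q assume "Q \<in> called B"
    then have "Q \<in> pnames D Skip" using assms by (auto simp: pnames_def)
    then have "\<exists>!d. d \<in> D \<and> fst d = Q" using decls by (simp add: program_def)
    then show "Q \<in> fst ` D" by blast
  qed
  then show "program L D B" using B decls by (subst program_iff) simp
  have "length us' = length us" if "(P, us', B') \<in> D" for us' B'
    using declared_unique[OF assms that] by simp
  moreover have "P \<in> fst ` D" using imageI[OF assms, of fst] by simp
  ultimately show "program L D (Call P (map Var us))"
    using decls by (subst program_iff) auto
qed

lemma derives_rule:
  "basic_rule I D cs c \<Longrightarrow> (\<And>c'. c' \<in> set cs \<Longrightarrow> derives \<Phi> c') \<Longrightarrow> triple_over L D c \<Longrightarrow> derives \<Phi> c"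
  by (rule derivable.step[of "basic_rule I D"])

lemma derives_consequence:
  assumes "derives \<Phi> (p1, S, q1)" "fm_over L p" "fm_over L q"
    and "\<And>\<sigma>. sat I \<sigma> p \<Longrightarrow> sat I \<sigma> p1" "\<And>\<sigma>. sat I \<sigma> q1 \<Longrightarrow> sat I \<sigma> q"
  shows "derives \<Phi> (p, S, q)"
proof (rule derives_rule)
  show "basic_rule I D [(p1, S, q1)] (p, S, q)"
    by (rule basic_rule.consequence) (use assms in \<open>auto simp: true_in_def\<close>)
  show "triple_over L D (p, S, q)" using derivable_over[OF assms(1)] assms by simp
qed (use assms in auto)

section \<open>Completeness for statements other than calls\<close>

lemma complete_Skip: "complete \<Phi> Skip"
  unfolding complete_def
proof (intro allI impI)
  fix p q :: "('f, 'r) fm"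
  assume *: "fm_over L p" "fm_over L q" "valid I D (p, Skip, q)"
  have "derives \<Phi> (p, Skip, p)"
    by (rule derives_rule[OF basic_rule.skip]) (use * decls in auto)
  then show "derives \<Phi> (p, Skip, q)"
    by (rule derives_consequence) (use * in \<open>auto simp: valid_iff intro: exec_Skip\<close>)
qed

lemma complete_Assign:
  assumes "program L D (Assign xs ts)"
  shows "complete \<Phi> (Assign xs ts)"
  unfolding complete_def
proof (intro allI impI)
  fix p q :: "('f, 'r) fm"
  assume *: "fm_over L p" "fm_over L q" "valid I D (p, Assign xs ts, q)"
  have ts: "\<And>t. t \<in> set ts \<Longrightarrow> tm_over L t" using assms by (simp add: program_def)
  have "derives \<Phi> (subst q xs ts, Assign xs ts, q)"
    by (rule derives_rule[OF basic_rule.parallel_assignment])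
      (use * ts assms in \<open>auto intro: fm_over_subst\<close>)
  then show "derives \<Phi> (p, Assign xs ts, q)"
    by (rule derives_consequence) (use * in \<open>auto simp: valid_iff sat_subst intro: exec_Assign\<close>)
qed

text \<open>The strongest postcondition \<open>sp p S1\<close> serves as the intermediate
  assertion.\<close>

lemma complete_Seq:
  assumes "program L D (Seq S1 S2)" "complete \<Phi> S1" "complete \<Phi> S2"
  shows "complete \<Phi> (Seq S1 S2)"
  unfolding complete_def
proof (intro allI impI)
  fix p q :: "('f, 'r) fm"
  assume *: "fm_over L p" "fm_over L q" "valid I D (p, Seq S1 S2, q)"
  have S1: "program L D S1" using assms(1) program_iff[of L D "Seq S1 S2"] program_iff[of L D S1] by auto
  note sp = fm_over_sp[OF *(1) S1] sat_sp[OF *(1) S1]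
  have "valid I D (p, S1, sp p S1)" "valid I D (sp p S1, S2, q)"
    using *(3) by (auto simp: valid_iff sp intro: exec_Seq)
  then have "derives \<Phi> (p, S1, sp p S1)" "derives \<Phi> (sp p S1, S2, q)"
    using assms * sp by (auto simp: complete_def)
  then show "derives \<Phi> (p, Seq S1 S2, q)"
    by (intro derives_rule[OF basic_rule.composition[of I D p S1 "sp p S1" S2 q]])
      (use * assms in auto)
qed

lemma complete_Cond:
  assumes "program L D (Cond B S1 S2)" "complete \<Phi> S1" "complete \<Phi> S2"
  shows "complete \<Phi> (Cond B S1 S2)"
  unfolding complete_def
proof (intro allI impI)
  fix p q :: "('f, 'r) fm"
  assume *: "fm_over L p" "fm_over L q" "valid I D (p, Cond B S1 S2, q)"
  have B: "fm_over L B" using assms(1) by (simp add: program_def)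
  have "valid I D (And p B, S1, q)" "valid I D (And p (Neg B), S2, q)"
    using *(3) by (auto simp: valid_iff intro: exec_Cond_true exec_Cond_false)
  then have "derives \<Phi> (And p B, S1, q)" "derives \<Phi> (And p (Neg B), S2, q)"
    using assms * B by (auto simp: complete_def)
  then show "derives \<Phi> (p, Cond B S1 S2, q)"
    by (intro derives_rule[OF basic_rule.conditional]) (use * assms in auto)
qed

text \<open>
  From strongest to weakest liberal preconditions: \<open>x + N\<close> is a fresh copy of the program
  variable \<open>x\<close>, and \<open>sp (\<And>x. x = x + N) S\<close> expresses the graph of \<open>S\<close>, the copies holding the
  initial values.
\<close>

lemma wlp_expressible:
  assumes S: "program L D S" and q: "fm_over L q"
  obtains w where "fm_over L w" "\<And>\<sigma>. sat I \<sigma> w \<longleftrightarrow> (\<forall>\<tau>. exec I D S \<sigma> \<tau> \<longrightarrow> sat I \<tau> q)"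
proof -
  let ?V = "prog_vars D S"
  obtain vs where vs: "set vs = ?V" using finite_list[OF finite_vars] by blast
  obtain N where N: "\<And>x. x \<in> ?V \<union> free q \<Longrightarrow> x < N"
    using finite_bound[of "?V \<union> free q"] finite_vars finite_free by blast
  define z :: "var \<Rightarrow> var" where "z = (\<lambda>x. x + N)"
  define Z where "Z = z ` ?V"
  define e :: "('f, 'r) fm" where "e = Eqs (map Var vs) (map (\<lambda>x. Var (z x)) vs)"
  \<comment> \<open>The quantified variables stand for the final values, while the substitution puts
    the current values in place of the copies, that is, of the initial values. Thus \<open>w\<close>
    denies that some run ends outside \<open>q\<close>.\<close>
  define w where
    "w = Neg (subst (Exs vs (And (sp e S) (Neg q))) (map (\<lambda>x. x + N) vs) (map (\<lambda>x. Var x) vs))"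
  have Z: "x \<notin> Z" if "x \<in> ?V \<union> free q" for x
    using N[OF that] by (auto simp: Z_def z_def)
  have zZ: "z x \<in> Z" "z x \<notin> ?V" if "x \<in> ?V" for x
    using Z that by (auto simp: Z_def)
  have e: "fm_over L e" by (auto simp: e_def intro!: fm_over_Eqs)
  have sat_e: "sat I \<sigma> e \<longleftrightarrow> (\<forall>x \<in> ?V. \<sigma> x = \<sigma> (z x))" for \<sigma>
    by (auto simp: e_def sat_Eqs vs[symmetric])
  note sp = fm_over_sp[OF e S] sat_sp[OF e S]
  have "fm_over L w" by (auto simp: w_def q sp intro!: fm_over_subst)
  moreover have "sat I \<sigma> w \<longleftrightarrow> (\<forall>\<tau>. exec I D S \<sigma> \<tau> \<longrightarrow> sat I \<tau> q)" for \<sigma>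
  proof -
    \<comment> \<open>The state in which the substituted formula is evaluated: the copies now hold
      the values of the program variables.\<close>
    define \<sigma>1 where "\<sigma>1 = (\<lambda>y. if y \<in> Z then \<sigma> (y - N) else \<sigma> y)"
    have \<sigma>1: "\<sigma>1 (z x) = \<sigma> x" "\<sigma>1 x = \<sigma> x" if "x \<in> ?V" for x
      using that zZ Z by (auto simp: \<sigma>1_def z_def)
    have upd: "upd \<sigma> (map (\<lambda>x. x + N) vs) (map (tm_val I \<sigma>) (map (\<lambda>x. Var x) vs)) = \<sigma>1"
      by (auto simp: fun_eq_iff upd_shift comp_def \<sigma>1_def Z_def z_def vs)
    have "sat I \<sigma> w \<longleftrightarrow>
        \<not> (\<exists>\<tau>. (\<forall>x. x \<notin> ?V \<longrightarrow> \<tau> x = \<sigma>1 x) \<and> (\<exists>\<rho>. sat I \<rho> e \<and> exec I D S \<rho> \<tau>) \<and> \<not> sat I \<tau> q)"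
      unfolding w_def by (simp only: sat.simps sat_subst upd sat_Exs vs sp)
    also have "\<dots> \<longleftrightarrow> (\<forall>\<tau>. exec I D S \<sigma> \<tau> \<longrightarrow> sat I \<tau> q)"
    proof -
      have "\<exists>\<tau>. exec I D S \<sigma> \<tau> \<and> \<not> sat I \<tau> q"
        if \<tau>: "\<forall>x. x \<notin> ?V \<longrightarrow> \<tau> x = \<sigma>1 x" and \<rho>: "sat I \<rho> e" "exec I D S \<rho> \<tau>" and nq: "\<not> sat I \<tau> q"
        for \<tau> \<rho>
      proof -
        \<comment> \<open>The run from \<open>\<rho>\<close> leaves the copies alone, so by
          \<open>e\<close> it starts with the values of \<open>\<sigma>\<close> on the program
          variables. Resetting the copies to their values in \<open>\<sigma>\<close> makes it a run
          from \<open>\<sigma>\<close> and does not affect \<open>q\<close>, where no copy is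
          free.\<close>
        define \<tau>' where "\<tau>' = (\<lambda>x. if x \<in> Z then \<sigma> x else \<tau> x)"
        have fr: "\<rho> x = \<sigma>1 x" if "x \<notin> ?V" for x
          using exec_frame[OF \<rho>(2) order_refl that] \<tau> that by simp
        have "exec I D S \<sigma> \<tau>'"
        proof (rule exec_coincidence[OF \<rho>(2) order_refl])
          fix x
          show "\<sigma> x = \<rho> x" if "x \<in> ?V"
            using that \<rho>(1) fr[OF zZ(2)[OF that]] \<sigma>1 by (simp add: sat_e)
          show "\<tau>' x = \<tau> x" if "x \<in> ?V" using that Z by (auto simp: \<tau>'_def)
          show "\<tau>' x = \<sigma> x" if "x \<notin> ?V" using that \<tau> by (auto simp: \<tau>'_def \<sigma>1_def)
        qed
        moreover have "sat I \<tau>' q \<longleftrightarrow> sat I \<tau> q"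
          by (rule sat_cong) (use Z in \<open>auto simp: \<tau>'_def\<close>)
        ultimately show ?thesis using nq by blast
      qed
      moreover have "\<exists>\<tau>. (\<forall>x. x \<notin> ?V \<longrightarrow> \<tau> x = \<sigma>1 x) \<and> (\<exists>\<rho>. sat I \<rho> e \<and> exec I D S \<rho> \<tau>) \<and> \<not> sat I \<tau> q"
        if \<tau>: "exec I D S \<sigma> \<tau>" and nq: "\<not> sat I \<tau> q" for \<tau>
      proof -
        define \<tau>' where "\<tau>' = (\<lambda>x. if x \<in> ?V then \<tau> x else \<sigma>1 x)"
        have "exec I D S \<sigma>1 \<tau>'"
          by (rule exec_coincidence[OF \<tau> order_refl]) (auto simp: \<sigma>1 \<tau>'_def)
        moreover have "sat I \<sigma>1 e" by (simp add: sat_e \<sigma>1)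
        moreover have "sat I \<tau>' q \<longleftrightarrow> sat I \<tau> q"
          by (rule sat_cong) (use Z exec_frame[OF \<tau> order_refl] in \<open>auto simp: \<tau>'_def \<sigma>1_def\<close>)
        moreover have "\<forall>x. x \<notin> ?V \<longrightarrow> \<tau>' x = \<sigma>1 x" by (simp add: \<tau>'_def)
        ultimately show ?thesis using nq by blast
      qed
      ultimately show ?thesis by blast
    qed
    finally show ?thesis .
  qed
  ultimately show ?thesis by (rule that)
qed

text \<open>The invariant is the weakest liberal precondition of the loop itself. An iteration
  followed by a run of the loop is again a run of the loop, so the body preserves it; when the guard
  fails the loop stops at once, so it yields \<open>q\<close>.\<close>

lemma complete_While:
  assumes W: "program L D (While B S)" and S: "complete \<Phi> S"
  shows "complete \<Phi> (While B S)"
  unfolding complete_def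
proof (intro allI impI)
  fix p q :: "('f, 'r) fm"
  assume *: "fm_over L p" "fm_over L q" "valid I D (p, While B S, q)"
  have B: "fm_over L B" using W by (simp add: program_def)
  obtain w where w: "fm_over L w"
    and sat_w: "\<And>\<sigma>. sat I \<sigma> w \<longleftrightarrow> (\<forall>\<tau>. exec I D (While B S) \<sigma> \<tau> \<longrightarrow> sat I \<tau> q)"
    by (rule wlp_expressible[OF W *(2)]) blast
  have "valid I D (And w B, S, w)"
    by (auto simp: valid_iff sat_w intro: exec_While_true)
  then have "derives \<Phi> (And w B, S, w)" using S B w by (auto simp: complete_def)
  then have "derives \<Phi> (w, While B S, And w (Neg B))"
    by (intro derives_rule[OF basic_rule.loop]) (use w B W in auto)
  then show "derives \<Phi> (p, While B S, q)"
    by (rule derives_consequence) (use * in \<open>auto simp: sat_w valid_iff intro: exec_While_false\<close>)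
qed

text \<open>
  If local variables occur in the postcondition, fresh variables first record their initial
  values. As a block does not change its local variables, SUBSTITUTION may afterwards put them
  back in place of the fresh ones.
\<close>

lemma complete_Block:
  assumes Bl: "program L D (Block xs ts S)" and S: "complete \<Phi> S"
  shows "complete \<Phi> (Block xs ts S)"
  unfolding complete_def
proof (intro allI impI)
  fix p q :: "('f, 'r) fm"
  assume *: "fm_over L p" "fm_over L q" "valid I D (p, Block xs ts S, q)"
  let ?V = "prog_vars D (Block xs ts S)"
  have Sq: "program L D (Seq (Assign xs ts) S)" and As: "program L D (Assign xs ts)"
    using Bl program_iff[of L D "Block xs ts S"] program_iff[of L D "Seq (Assign xs ts) S"]
      program_iff[of L D "Assign xs ts"] by auto
  have V: "prog_vars D (Seq (Assign xs ts) S) = ?V" "set xs \<subseteq> ?V"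
    by (auto simp: prog_vars_def)
  obtain N where N: "\<And>x. x \<in> ?V \<union> free p \<union> free q \<Longrightarrow> x < N"
    using finite_bound[of "?V \<union> free p \<union> free q"] finite_vars finite_free by blast
  define y :: "var \<Rightarrow> var" where "y = (\<lambda>x. x + N)"
  have y: "y x \<notin> ?V \<union> free p \<union> free q" for x using N[of "y x"] by (auto simp: y_def)
  define p1 where "p1 = And p (Eqs (map Var xs) (map (\<lambda>x. Var (y x)) xs))"
  define q1 where "q1 = subst q xs (map (\<lambda>x. Var (y x)) xs)"
  have over: "fm_over L p1" "fm_over L q1"
    using * by (auto simp: p1_def q1_def intro!: fm_over_Eqs fm_over_subst)
  have sat_p1: "sat I \<sigma> p1 \<longleftrightarrow> sat I \<sigma> p \<and> (\<forall>x \<in> set xs. \<sigma> x = \<sigma> (y x))" for \<sigma>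
    by (auto simp: p1_def sat_Eqs)
  have sat_q1: "sat I \<sigma> q1 \<longleftrightarrow> sat I (\<lambda>x. if x \<in> set xs then \<sigma> (y x) else \<sigma> x) q" for \<sigma>
  proof -
    have "upd \<sigma> xs (map (tm_val I \<sigma>) (map (\<lambda>x. Var (y x)) xs))
        = (\<lambda>x. if x \<in> set xs then \<sigma> (y x) else \<sigma> x)"
      by (auto simp: fun_eq_iff comp_def upd_map)
    then show ?thesis by (simp only: q1_def sat_subst)
  qed
  have "valid I D (p1, Seq (Assign xs ts) S, q1)"
    unfolding valid_iff
  proof (intro allI impI)
    fix \<sigma> \<tau>
    assume \<sigma>: "sat I \<sigma> p1" and ex: "exec I D (Seq (Assign xs ts) S) \<sigma> \<tau>"
    \<comment> \<open>The fresh variables lie outside the program and survive the run; restoring the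
      locals from \<open>\<sigma>\<close> therefore amounts to reading the fresh variables in
      \<open>\<tau>\<close>.\<close>
    have "\<tau> (y x) = \<sigma> (y x)" for x
      using exec_frame[OF ex, of ?V "y x"] V y by auto
    then have "upd \<tau> xs (map \<sigma> xs) = (\<lambda>x. if x \<in> set xs then \<tau> (y x) else \<tau> x)"
      using \<sigma> by (auto simp: upd_map sat_p1)
    moreover have "sat I (upd \<tau> xs (map \<sigma> xs)) q"
      using *(3) \<sigma> exec_Block[OF ex] by (auto simp: valid_iff sat_p1)
    ultimately show "sat I \<tau> q1" by (simp add: sat_q1)
  qed
  \<comment> \<open>The statement in the premise of BLOCK is not a component of the block, so its
    completeness is assembled from that of the assignment and that of the body.\<close>
  then have "derives \<Phi> (p1, Seq (Assign xs ts) S, q1)"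
    using complete_Seq[OF Sq complete_Assign[OF As] S] over by (auto simp: complete_def)
  moreover have "set xs \<inter> free q1 = {}"
    using free_subst_Var[of q xs y] y V(2) unfolding q1_def by blast
  ultimately have "derives \<Phi> (p1, Block xs ts S, q1)"
    by (intro derives_rule[OF basic_rule.block]) (use over Bl in auto)
  moreover have "set (map (\<lambda>x. x + N) xs) \<inter> ?V = {}" using y by (auto simp: y_def)
  moreover have "distinct (map (\<lambda>x. x + N) xs)"
    using Bl by (auto simp: program_def distinct_map inj_on_def)
  moreover have "set xs \<inter> change D (Block xs ts S) = {}" by (auto simp: change_def)
  ultimately have renamed: "derives \<Phi> (subst p1 (map (\<lambda>x. x + N) xs) (map Var xs), Block xs ts S,
      subst q1 (map (\<lambda>x. x + N) xs) (map Var xs))"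
    by (intro derives_rule[OF basic_rule.substitution])
      (use over Bl in \<open>auto intro!: fm_over_subst\<close>)
  \<comment> \<open>The effect on states of substituting the locals for the fresh variables. Neither
    \<open>p\<close> nor \<open>q\<close> notices it, and it makes the equations added in
    \<open>p1\<close> true.\<close>
  define put where "put = (\<lambda>(\<sigma> :: 'a state) v. if v \<in> y ` set xs then \<sigma> (v - N) else \<sigma> v)"
  have upd: "upd \<sigma> (map (\<lambda>x. x + N) xs) (map (tm_val I \<sigma>) (map Var xs)) = put \<sigma>" for \<sigma>
    by (auto simp: fun_eq_iff upd_shift comp_def put_def y_def)
  have put: "put \<sigma> (y x) = \<sigma> x" if "x \<in> set xs" for x \<sigma>
    using that by (auto simp: put_def y_def)
  have put': "put \<sigma> x = \<sigma> x" if "x \<in> ?V \<union> free p \<union> free q" for x \<sigma>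
    using that y by (auto simp: put_def)
  have p: "sat I \<sigma> (subst p1 (map (\<lambda>x. x + N) xs) (map Var xs))" if "sat I \<sigma> p" for \<sigma>
  proof -
    have "sat I (put \<sigma>) p \<longleftrightarrow> sat I \<sigma> p" by (rule sat_cong) (simp add: put')
    then show ?thesis using that V(2) unfolding sat_subst upd sat_p1 by (auto simp: put put')
  qed
  have q: "sat I \<sigma> q" if "sat I \<sigma> (subst q1 (map (\<lambda>x. x + N) xs) (map Var xs))" for \<sigma>
  proof -
    have "sat I (\<lambda>x. if x \<in> set xs then put \<sigma> (y x) else put \<sigma> x) q \<longleftrightarrow> sat I \<sigma> q"
      by (rule sat_cong) (simp add: put put')
    then show ?thesis using that by (simp only: sat_subst upd sat_q1)
  qed
  show "derives \<Phi> (p, Block xs ts S, q)"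
    by (rule derives_consequence[OF renamed *(1,2)]) (fact p q)+
qed

section \<open>Specifications describing the graphs of procedures\<close>

definition decl_vars :: "var list" where
  "decl_vars = sorted_list_of_set (prog_vars D Skip)"

text \<open>The successor makes every shifted variable exceed all variables of the declarations;
  inserting 0 keeps the maximum defined when there are none.\<close>

definition copy_offset :: nat where
  "copy_offset = Suc (Max (insert 0 (prog_vars D Skip)))"

text \<open>One precondition for all procedures. It freezes the variables of every declaration,
  because a body may reach all of them through calls.\<close>

definition frozen_pre :: "('f, 'r) fm" where
  "frozen_pre = Eqs (map Var decl_vars) (map (\<lambda>x. Var (x + copy_offset)) decl_vars)"

text \<open>RECURSION indexes specifications by procedure names, so the declaration is recovered
  from the name; it is unique.\<close>

definition graph_post :: "pname \<Rightarrow> ('f, 'r) fm" where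
  "graph_post P = (case SOME d. (P, d) \<in> D of (us, B) \<Rightarrow> Exs us (sp frozen_pre B))"

definition graph_specs :: "('f, 'r) triple set" where
  "graph_specs = {(frozen_pre, Call P (map Var us), graph_post P) | P us B. (P, us, B) \<in> D}"

lemma set_decl_vars: "set decl_vars = prog_vars D Skip"
  by (simp add: decl_vars_def finite_vars)

lemma copy_fresh: "x + copy_offset \<notin> prog_vars D Skip"
proof
  assume "x + copy_offset \<in> prog_vars D Skip"
  then have "x + copy_offset \<le> Max (insert 0 (prog_vars D Skip))"
    by (intro Max_ge) (auto simp: finite_vars)
  then show False by (simp add: copy_offset_def)
qed

lemma fm_over_frozen_pre: "fm_over L frozen_pre"
  by (auto simp: frozen_pre_def intro!: fm_over_Eqs)

lemma sat_frozen_pre: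
  "sat I \<sigma> frozen_pre \<longleftrightarrow> (\<forall>x \<in> prog_vars D Skip. \<sigma> x = \<sigma> (x + copy_offset))"
  by (auto simp: frozen_pre_def sat_Eqs set_decl_vars)

lemma graph_post_eq:
  assumes "(P, us, B) \<in> D"
  shows "graph_post P = Exs us (sp frozen_pre B)"
proof -
  have "(P, SOME d. (P, d) \<in> D) \<in> D" using assms by (rule someI)
  then have "(SOME d. (P, d) \<in> D) = (us, B)"
    using declared_unique[OF assms] by (cases "SOME d. (P, d) \<in> D") auto
  then show ?thesis by (simp add: graph_post_def)
qed

text \<open>Quantifying the formal parameters away secures the side condition of RECURSION. The
  state \<open>\<rho>\<close> is the one at the end of the body, and \<open>\<tau>\<close> may
  differ from it on the formal parameters.\<close>

lemma graph_post:
  assumes "(P, us, B) \<in> D"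
  shows "fm_over L (graph_post P)" "set us \<inter> free (graph_post P) = {}"
    and "sat I \<tau> (graph_post P) \<longleftrightarrow>
      (\<exists>\<rho> \<sigma>. (\<forall>x. x \<notin> set us \<longrightarrow> \<rho> x = \<tau> x) \<and> sat I \<sigma> frozen_pre \<and> exec I D B \<sigma> \<rho>)"
proof -
  note sp = fm_over_sp[OF fm_over_frozen_pre declared_wf(2)[OF assms]]
    sat_sp[OF fm_over_frozen_pre declared_wf(2)[OF assms]]
  show "fm_over L (graph_post P)" "set us \<inter> free (graph_post P) = {}"
    by (auto simp: graph_post_eq[OF assms] sp free_Exs)
  show "sat I \<tau> (graph_post P) \<longleftrightarrow>
      (\<exists>\<rho> \<sigma>. (\<forall>x. x \<notin> set us \<longrightarrow> \<rho> x = \<tau> x) \<and> sat I \<sigma> frozen_pre \<and> exec I D B \<sigma> \<rho>)"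
    by (auto simp: graph_post_eq[OF assms] sp sat_Exs)
qed

text \<open>The final state of the body is itself a witness for the quantified formal
  parameters.\<close>

lemma valid_body:
  assumes "(P, us, B) \<in> D"
  shows "valid I D (frozen_pre, B, graph_post P)"
  unfolding valid_iff graph_post(3)[OF assms] by blast

section \<open>Completeness for procedure calls\<close>

lemma complete_Call:
  assumes C: "program L D (Call P ts)"
  shows "complete graph_specs (Call P ts)"
  unfolding complete_def
proof (intro allI impI)
  fix p q :: "('f, 'r) fm"
  assume *: "fm_over L p" "fm_over L q" "valid I D (p, Call P ts, q)"
  obtain us B where d: "(P, us, B) \<in> D"
    using C program_iff[of L D "Call P ts"] by auto
  let ?V = "prog_vars D Skip" and ?T = "\<Union> (set (map tm_vars ts))" and ?M = copy_offset
  let ?vs = decl_vars and ?ws = "filter (\<lambda>x. x \<notin> set us) decl_vars"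
  have ts: "length ts = length us" "\<And>t. t \<in> set ts \<Longrightarrow> tm_over L t"
    using C d by (auto simp: program_def)
  have us: "distinct us" "set us \<subseteq> ?V" using declared_wf(1)[OF d] prog_vars_declared[OF d] by auto
  have BV: "prog_vars D B \<subseteq> ?V" using prog_vars_declared[OF d] prog_vars_eq[of D B] by auto
  have ws: "set ?ws = ?V - set us" by (auto simp: set_decl_vars)
  have fin: "finite (?V \<union> (\<lambda>x. x + ?M) ` ?V \<union> ?T \<union> free p \<union> free q)"
    using finite_vars finite_free finite_tm_vars by auto
  \<comment> \<open>The copies at distance \<open>copy_offset\<close> were fixed before
    \<open>p\<close>, \<open>q\<close> and \<open>ts\<close> were given and may occur in them; the
    offset \<open>N\<close> gives copies that avoid these as well.\<close>
  obtain N where N: "\<And>x. x \<in> ?V \<union> (\<lambda>x. x + ?M) ` ?V \<union> ?T \<union> free p \<union> free q \<Longrightarrow> x < N"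
    using finite_bound[OF fin] by blast
  define z :: "var \<Rightarrow> var" where "z = (\<lambda>x. x + N)"
  have z: "z x \<notin> ?V" "z x \<notin> (\<lambda>x. x + ?M) ` ?V" "z x \<notin> ?T" "z x \<notin> free p" "z x \<notin> free q" for x
    using N[of "z x"] by (auto simp: z_def)

  define pre where "pre = subst frozen_pre (map (\<lambda>x. x + ?M) ?vs) (map (\<lambda>x. Var (z x)) ?vs)"
  define post where "post = subst (graph_post P) (map (\<lambda>x. x + ?M) ?vs) (map (\<lambda>x. Var (z x)) ?vs)"
  \<comment> \<open>The copies of the formal parameters hold the values passed to the body, not the
    values from before the call. The latter are available only in the formal parameters themselves,
    which the call restores, so these are left unsubstituted.\<close>
  define r where
    "r = subst (And p (Eqs (map (\<lambda>x. Var (z x)) us) ts)) ?ws (map (\<lambda>x. Var (z x)) ?ws)"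
  \<comment> \<open>\<open>frz\<close> is the state in which the specification is evaluated once its
    copies are replaced by those at distance \<open>N\<close>; \<open>ini\<close> rebuilds the state
    before the call from a state after it.\<close>
  define frz where "frz = (\<lambda>(\<tau> :: 'a state) v. if v \<in> (\<lambda>x. x + ?M) ` ?V then \<tau> (z (v - ?M)) else \<tau> v)"
  define ini where "ini = (\<lambda>(\<tau> :: 'a state) x. if x \<in> ?V - set us then \<tau> (z x) else \<tau> x)"
  have over: "fm_over L pre" "fm_over L post" "fm_over L r" "fm_over L (subst pre us ts)"
    using * ts fm_over_frozen_pre graph_post(1)[OF d]
    by (auto simp: pre_def post_def r_def intro!: fm_over_subst fm_over_Eqs)
  have updM: "upd \<tau> (map (\<lambda>x. x + ?M) ?vs) (map (tm_val I \<tau>) (map (\<lambda>x. Var (z x)) ?vs)) = frz \<tau>" for \<tau>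
    by (auto simp: fun_eq_iff upd_shift comp_def frz_def set_decl_vars)
  have updw: "upd \<tau> ?ws (map (tm_val I \<tau>) (map (\<lambda>x. Var (z x)) ?ws)) = ini \<tau>" for \<tau>
    unfolding map_map comp_def tm_val.simps upd_map ini_def ws by (rule refl)
  have frz: "frz \<tau> (x + ?M) = \<tau> (z x)" "frz \<tau> x = \<tau> x" if "x \<in> ?V" for \<tau> x
    using that copy_fresh by (auto simp: frz_def)
  have ini_z: "ini \<tau> (z x) = \<tau> (z x)" for \<tau> x using z(1) by (auto simp: ini_def)
  have sat_pre: "sat I \<tau> pre \<longleftrightarrow> (\<forall>x \<in> ?V. \<tau> x = \<tau> (z x))" for \<tau>
    unfolding pre_def sat_subst updM sat_frozen_pre by (simp add: frz)
  have sat_r: "sat I \<tau> r \<longleftrightarrow>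
      sat I (ini \<tau>) p \<and> map (\<lambda>x. \<tau> (z x)) us = map (tm_val I (ini \<tau>)) ts" for \<tau>
    unfolding r_def sat_subst updw sat.simps by (simp add: sat_Eqs ts comp_def ini_z)

  have hyp: "derives graph_specs (frozen_pre, Call P (map Var us), graph_post P)"
    by (rule derivable.hyp)
      (use d declared_wf(3)[OF d] fm_over_frozen_pre graph_post(1)[OF d] in
        \<open>auto simp: graph_specs_def\<close>)
  have vars_us: "prog_vars D (Call P (map Var us)) = ?V"
    using us by (auto simp: prog_vars_def)
  have pre_post: "pre = subst frozen_pre (map (\<lambda>x. x + ?M) ?vs) (map Var (map z ?vs))"
    "post = subst (graph_post P) (map (\<lambda>x. x + ?M) ?vs) (map Var (map z ?vs))"
    by (simp_all add: pre_def post_def comp_def)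
  have "basic_rule I D [(frozen_pre, Call P (map Var us), graph_post P)]
      (pre, Call P (map Var us), post)"
    unfolding pre_post
  proof (rule basic_rule.substitution)
    show "distinct (map (\<lambda>x. x + ?M) ?vs)"
      by (auto simp: distinct_map inj_on_def decl_vars_def)
    show "set (map (\<lambda>x. x + ?M) ?vs) \<inter> prog_vars D (Call P (map Var us)) = {}"
      unfolding vars_us using copy_fresh by auto
    show "set (map z ?vs) \<inter> change D (Call P (map Var us)) = {}"
      using z(1) change_prog_vars[of D "Call P (map Var us)"] unfolding vars_us by auto
  qed simp
  then have "derives graph_specs (pre, Call P (map Var us), post)"
    by (rule derives_rule) (use hyp over declared_wf(3)[OF d] in auto)
  moreover have "set us \<inter> free post = {}"
    using free_subst_shift[of "graph_post P" ?M ?vs z] graph_post(2)[OF d] z(1) us(2)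
    unfolding post_def by blast
  ultimately have "derives graph_specs (subst pre us ts, Call P ts, post)"
    by (intro derives_rule[OF basic_rule.procedure_call[OF d]]) (use over C in auto)
  moreover have "free r \<inter> change D (Call P ts) = {}"
  proof -
    have "change D (Call P ts) \<subseteq> ?V - set us"
      using change_Call_declared[OF decls d] decls_change_prog_vars[of D Skip] by auto
    moreover have "free r \<inter> set ?ws = {}"
      using free_subst_Var[of "And p (Eqs (map (\<lambda>x. Var (z x)) us) ts)" ?ws z] z(1) ws
      unfolding r_def by blast
    ultimately show ?thesis unfolding ws by blast
  qed
  ultimately have inv: "derives graph_specs (And r (subst pre us ts), Call P ts, And r post)"
    by (intro derives_rule[OF basic_rule.invariance]) (use over C in auto)

  \<comment> \<open>The run of the body recorded by \<open>post\<close> is turned into a run of the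
    call from \<open>ini \<tau>\<close> to \<open>\<tau>\<close>; since \<open>r\<close> gives
    \<open>p\<close> in \<open>ini \<tau>\<close>, validity applies.\<close>
  have post_q: "sat I \<tau> q" if "sat I \<tau> (And r post)" for \<tau>
  proof -
    have p: "sat I (ini \<tau>) p" and args: "map (\<lambda>x. \<tau> (z x)) us = map (tm_val I (ini \<tau>)) ts"
      using that by (auto simp: sat_r)
    have "sat I (frz \<tau>) (graph_post P)"
      using that unfolding post_def sat.simps sat_subst updM by simp
    then obtain \<rho> \<sigma> where \<rho>: "\<And>x. x \<notin> set us \<Longrightarrow> \<rho> x = frz \<tau> x"
      and \<sigma>: "\<And>x. x \<in> ?V \<Longrightarrow> \<sigma> x = \<sigma> (x + ?M)" and ex: "exec I D B \<sigma> \<rho>"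
      unfolding graph_post(3)[OF d] sat_frozen_pre by blast
    \<comment> \<open>The body leaves the copies of the specification unchanged, and
      \<open>frz \<tau>\<close> takes their values from the copies at distance
      \<open>N\<close>.\<close>
    have \<sigma>z: "\<sigma> x = \<tau> (z x)" if "x \<in> ?V" for x
    proof -
      have "x + ?M \<notin> set us" using us(2) copy_fresh by auto
      then show ?thesis
        using \<sigma>[OF that] exec_frame[OF ex BV copy_fresh, of x] \<rho>[of "x + ?M"] frz that by simp
    qed
    \<comment> \<open>The state at the end of the body, before the formal parameters are restored;
      \<open>?\<sigma>1\<close> is the state just after parameter passing. By \<open>args\<close>,
      the latter agrees with the copies on all variables of the declarations.\<close>
    define \<tau>2 where "\<tau>2 = (\<lambda>x. if x \<in> set us then \<rho> x else \<tau> x)"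
    let ?\<sigma>1 = "upd (ini \<tau>) us (map (tm_val I (ini \<tau>)) ts)"
    have \<sigma>1: "?\<sigma>1 x = (if x \<in> ?V then \<tau> (z x) else \<tau> x)" for x
      unfolding args[symmetric] upd_map using us(2) by (auto simp: ini_def)
    have "exec I D B ?\<sigma>1 \<tau>2"
    proof (rule exec_coincidence[OF ex BV])
      fix x
      show "?\<sigma>1 x = \<sigma> x" if "x \<in> ?V" using that by (simp add: \<sigma>1 \<sigma>z)
      show "\<tau>2 x = \<rho> x" if "x \<in> ?V" using that \<rho> frz by (simp add: \<tau>2_def)
      show "\<tau>2 x = ?\<sigma>1 x" if "x \<notin> ?V" using that us(2) by (auto simp: \<sigma>1 \<tau>2_def)
    qed
    then have "exec I D (Call P ts) (ini \<tau>) (upd \<tau>2 us (map (ini \<tau>) us))"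
      by (intro exec_Call[OF d] exec_Block exec_Seq[OF exec_Assign])
    moreover have "upd \<tau>2 us (map (ini \<tau>) us) = \<tau>"
      by (auto simp: fun_eq_iff upd_map ini_def \<tau>2_def)
    ultimately show ?thesis using *(3) p unfolding valid_iff by metis
  qed
  have "derives graph_specs (And r (subst pre us ts), Call P ts, q)"
    by (rule derives_consequence[OF inv]) (use over *(2) post_q in auto)
  moreover have "set (map z ?vs) \<inter> (prog_vars D (Call P ts) \<union> free q) = {}"
    using z prog_vars_eq[of D "Call P ts"] by auto
  ultimately have "derives graph_specs (Exs (map z ?vs) (And r (subst pre us ts)), Call P ts, q)"
    by (intro derives_rule[OF basic_rule.exists_introduction]) (use over *(2) C in auto)
  then show "derives graph_specs (p, Call P ts, q)"
  proof (rule derives_consequence)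
    fix \<sigma>
    assume p: "sat I \<sigma> p"
    \<comment> \<open>Witness for the quantified copies: in \<open>\<sigma>'\<close> they hold the
      values just after parameter passing. This satisfies both the equations in \<open>r\<close> and
      the precondition \<open>pre\<close> at the actual parameters.\<close>
    define \<sigma>1 where "\<sigma>1 = upd \<sigma> us (map (tm_val I \<sigma>) ts)"
    define \<sigma>' where "\<sigma>' = (\<lambda>v. if v \<in> z ` ?V then \<sigma>1 (v - N) else \<sigma> v)"
    have \<sigma>'z: "\<sigma>' (z x) = \<sigma>1 x" if "x \<in> ?V" for x using that by (auto simp: \<sigma>'_def z_def)
    have \<sigma>'_same: "\<sigma>' x = \<sigma> x" if "x \<in> ?V \<union> ?T \<union> free p" for x
      using that z by (auto simp: \<sigma>'_def)
    have ini_same: "ini \<sigma>' x = \<sigma> x" if "x \<in> ?V \<union> ?T \<union> free p" for x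
      using that \<sigma>'_same \<sigma>'z by (auto simp: ini_def \<sigma>1_def upd_notin)
    have ini_p: "sat I (ini \<sigma>') p \<longleftrightarrow> sat I \<sigma> p" by (rule sat_cong) (simp add: ini_same)
    have ini_ts: "map (tm_val I (ini \<sigma>')) ts = map (tm_val I \<sigma>) ts"
      by (intro map_cong refl tm_val_cong ini_same) auto
    have \<sigma>'_ts: "map (tm_val I \<sigma>') ts = map (tm_val I \<sigma>) ts"
      by (intro map_cong refl tm_val_cong \<sigma>'_same) auto
    have "map (\<lambda>x. \<sigma>' (z x)) us = map \<sigma>1 us"
      by (intro map_cong refl \<sigma>'z) (use us(2) in auto)
    also have "\<dots> = map (tm_val I \<sigma>) ts"
      unfolding \<sigma>1_def by (rule map_upd) (use us ts in auto)
    finally have "sat I \<sigma>' r" using p by (simp add: sat_r ini_p ini_ts)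
    moreover have "sat I \<sigma>' (subst pre us ts)"
      unfolding sat_subst sat_pre \<sigma>'_ts
    proof
      fix x
      assume x: "x \<in> ?V"
      have "z x \<notin> set us" using z(1) us(2) by auto
      moreover have "upd \<sigma>' us (map (tm_val I \<sigma>) ts) x = \<sigma>1 x"
        unfolding \<sigma>1_def by (rule upd_cong[of x ?V]) (use x \<sigma>'_same in auto)
      ultimately show "upd \<sigma>' us (map (tm_val I \<sigma>) ts) x = upd \<sigma>' us (map (tm_val I \<sigma>) ts) (z x)"
        by (simp add: upd_notin \<sigma>'z x)
    qed
    moreover have "\<forall>v. v \<notin> set (map z ?vs) \<longrightarrow> \<sigma>' v = \<sigma> v"
      by (simp add: \<sigma>'_def set_decl_vars)
    ultimately show "sat I \<sigma> (Exs (map z ?vs) (And r (subst pre us ts)))"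
      unfolding sat_Exs by (intro exI[of _ \<sigma>'] conjI) simp_all
  qed (use * in auto)
qed

section \<open>Completeness of the whole system\<close>

text \<open>Structural induction suffices even for recursive procedures: a call is handled through
  its specification, and no body is unfolded.\<close>

lemma complete_from_graph_specs: "program L D S \<Longrightarrow> complete graph_specs S"
proof (induction S)
  case Skip
  show ?case by (rule complete_Skip)
next
  case (Assign xs ts)
  then show ?case by (rule complete_Assign)
next
  case (Call P ts)
  then show ?case by (rule complete_Call)
next
  case (Seq S1 S2)
  then have "program L D S1" "program L D S2"
    using program_iff[of L D "Seq S1 S2"] program_iff[of L D S1] program_iff[of L D S2] by auto
  then show ?case using Seq by (intro complete_Seq) auto
next
  case (Cond B S1 S2)
  then have "program L D S1" "program L D S2"
    using program_iff[of L D "Cond B S1 S2"] program_iff[of L D S1] program_iff[of L D S2] by auto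
  then show ?case using Cond by (intro complete_Cond) auto
next
  case (While B S)
  then have "program L D S"
    using program_iff[of L D "While B S"] program_iff[of L D S] by auto
  then show ?case using While by (intro complete_While) auto
next
  case (Block xs ts S)
  then have "program L D S"
    using program_iff[of L D "Block xs ts S"] program_iff[of L D S] by auto
  then show ?case using Block by (intro complete_Block) auto
qed

text \<open>Completeness relative to \<open>graph_specs\<close> is applied to the statement and to
  every body, which yields the premises of RECURSION. That rule is used once, as the last
  step.\<close>

lemma cook_complete:
  assumes S: "program L D S" and over: "fm_over L p" "fm_over L q" and val: "valid I D (p, S, q)"
  shows "cbv_derivable L I D (p, S, q)"
proof -
  have "derives graph_specs (p, S, q)"
    using complete_from_graph_specs[OF S] over val by (auto simp: complete_def)
  moreover have "derives graph_specs (frozen_pre, B, graph_post P)" if "(P, us, B) \<in> D" for P us B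
    using complete_from_graph_specs[OF declared_wf(2)[OF that]] fm_over_frozen_pre
      graph_post(1)[OF that] valid_body[OF that] by (auto simp: complete_def)
  ultimately have "recursion_rule L I D [] (p, S, q)"
    by (intro recursion_rule.recursion[where pre = "\<lambda>_. frozen_pre" and post = graph_post])
      (use graph_post(2) in \<open>auto simp: graph_specs_def\<close>)
  then have "basic_rule I D [] (p, S, q) \<or> recursion_rule L I D [] (p, S, q)" ..
  then show ?thesis
    unfolding cbv_derivable_def by (rule derivable.step) (use S over in auto)
qed

end

theorem theorem2:
  fixes L :: "('f, 'r) lang"
    and I :: "('f, 'r, 'a) interp"
    and D :: "('f, 'r) decl set"
    and S :: "('f, 'r) stmt"
    and p q :: "('f, 'r) fm"
  assumes "expressive L I"
    and "program L D S"
    and "fm_over L p"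
    and "fm_over L q"
    and "valid I D (p, S, q)"
  shows "cbv_derivable L I D (p, S, q)"
proof -
  interpret cook_setting L I D
    by unfold_locales (use assms(1,2) program_iff[of L D S] in auto)
  show ?thesis using assms(2-5) by (rule cook_complete)
qed

end
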